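(* Let $H$ be a real Hilbert space, $F:H\to H$, and $z_0\in H$. Assume: (a) the equation $F(z)=0$ has a unique solution $y\in H$; (b) $F$ is twice Fréchet differentiable, and there are positive constants $N_1,N_2$ with $\|F'(x)\|\le N_1$, $\|F''(x)\|\le N_2$ for all $x\in H$; (c) for some $v\in H$ and some $\zeta\in[\frac12,1]$ one has $y-z_0=T^\zeta(y)v$; (d) $\varepsilon:[0,\infty)\to(0,\infty)$ is such that for all $t\ge0$ $$\left[\frac12\varepsilon^{\zeta-\frac12}(t)N_2\zeta^\zeta(1-\zeta)^{1-\zeta}+\frac{N_1^{2(\zeta+\frac12)}N_2}{N_1^2+\varepsilon(t)}\right]\|v\|<1 .$$ Put $$\Phi(h,t):=-T^{-1}_{\varepsilon(t)}(h)\{F'^{*}(h)F(h)+\varepsilon(t)(h-z_0)\},$$ $$\gamma(t):=1-\frac12\varepsilon^{\zeta-\frac12}(t)N_2\zeta^\zeta(1-\zeta)^{1-\zeta}\|v\|-\frac{N_1^{2(\zeta+\frac12)}N_2\|v\|}{N_1^2+\varepsilon(t)}.$$ Suppose moreover that: 1. $\varepsilon(t)$ is continuously differentiable, tends monotonically to $0$ as $t\to+\infty$, and $$C_0:=\min_{t\in[0,+\infty)}\left\{\gamma(t)-\zeta\frac{|\dot\varepsilon(t)|}{\varepsilon(t)}\right\}>0;$$ 2. $$\frac{N_2\,\varepsilon^{\zeta-\frac12}(0)}{2C_0}<\min\left\{\frac{C_0}{2\zeta^\zeta(1-\zeta)^{1-\zeta}\|v\|},\frac{\varepsilon^\zeta(0)}{\|y-z_0\|}\right\}.$$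 Then the Cauchy problem $\dot z(t)=\Phi(z(t),t)$, $z(0)=z_0$, has a unique solution $z(t)$ for $t\in[0,+\infty)$, and $$\|z(t)-y\|\le\frac{2C_0}{N_2\,\varepsilon^{\zeta-\frac12}(0)}\,\varepsilon^\zeta(t),\qquad t\ge0.$$
   Context: For $h\in H$, $F'(h)$ is the Fréchet derivative, $F'^{*}(h)$ its adjoint, $T(h):=F'^{*}(h)F'(h)$, and $T_\varepsilon(h):=T(h)+\varepsilon I$ for $\varepsilon>0$, where $I$ is the identity operator; $T^\zeta(y)$ is the $\zeta$-th power of the nonnegative self-adjoint operator $T(y)$. By convention $(1-\zeta)^{1-\zeta}:=1$ for $\zeta=1$. A dot denotes the derivative with respect to $t$, and $\varepsilon^{\zeta}(t)=(\varepsilon(t))^\zeta$. *)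

theory Defs
  imports "HOL-Analysis.Analysis" "HOL-Computational_Algebra.Polynomial"
begin

text \<open>A real Hilbert space is a type of sort \<open>{real_inner, banach}\<close>. There every bounded
  operator has an adjoint, which is unique and bounded, so the choice in the library's
  \<^const>\<open>adjoint\<close> and the coercion \<^const>\<open>Blinfun\<close> are both harmless.\<close>

definition blinfun_adjoint ::
    "('a::{real_inner,banach} \<Rightarrow>\<^sub>L 'b::{real_inner,banach}) \<Rightarrow> ('b \<Rightarrow>\<^sub>L 'a)" where
  "blinfun_adjoint A = Blinfun (adjoint (blinfun_apply A))"

definition poly_blinfun ::
    "real poly \<Rightarrow> ('a::real_normed_vector \<Rightarrow>\<^sub>L 'a) \<Rightarrow> ('a \<Rightarrow>\<^sub>L 'a)" where
  "poly_blinfun p A = (\<Sum>i\<le>degree p. coeff p i *\<^sub>R (((o\<^sub>L) A ^^ i) id_blinfun))"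

text \<open>For a nonnegative self-adjoint operator \<open>A\<close>, whose spectrum lies in \<open>[0, norm A]\<close>, and
  \<open>s > 0\<close>, the power \<open>A\<^sup>s\<close> is given by the continuous functional calculus: it is the limit in
  operator norm of \<open>p\<^sub>n(A)\<close> for any polynomials \<open>p\<^sub>n\<close> that tend to \<open>\<lambda>\<^sup>s\<close> uniformly
  on \<open>[0, norm A]\<close>.\<close>

definition blinfun_powr ::
    "('a::{real_inner,banach} \<Rightarrow>\<^sub>L 'a) \<Rightarrow> real \<Rightarrow> ('a \<Rightarrow>\<^sub>L 'a)" where
  "blinfun_powr A s =
     (THE S. \<forall>p :: nat \<Rightarrow> real poly.
        uniform_limit {0..norm A} (\<lambda>n. poly (p n)) (\<lambda>x. x powr s) sequentially
          \<longrightarrow> (\<lambda>n. poly_blinfun (p n) A) \<longlonglongrightarrow> S)"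

definition Top ::
    "('a::{real_inner,banach} \<Rightarrow> 'a \<Rightarrow>\<^sub>L 'a) \<Rightarrow> 'a \<Rightarrow> ('a \<Rightarrow>\<^sub>L 'a)" where
  "Top F' h = blinfun_adjoint (F' h) o\<^sub>L F' h"

definition Treg ::
    "('a::{real_inner,banach} \<Rightarrow> 'a \<Rightarrow>\<^sub>L 'a) \<Rightarrow> real \<Rightarrow> 'a \<Rightarrow> ('a \<Rightarrow>\<^sub>L 'a)" where
  "Treg F' e h = Top F' h + e *\<^sub>R id_blinfun"

definition Phi ::
    "('a::{real_inner,banach} \<Rightarrow> 'a) \<Rightarrow> ('a \<Rightarrow> 'a \<Rightarrow>\<^sub>L 'a) \<Rightarrow> 'a \<Rightarrow> (real \<Rightarrow> real)
      \<Rightarrow> 'a \<Rightarrow> real \<Rightarrow> 'a" where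
  "Phi F F' z0 \<epsilon> h t =
     - inv (blinfun_apply (Treg F' (\<epsilon> t) h))
         (blinfun_adjoint (F' h) (F h) + \<epsilon> t *\<^sub>R (h - z0))"

text \<open>\<open>\<zeta>\<^sup>\<zeta> (1 - \<zeta>)\<^sup>1\<^sup>-\<^sup>\<zeta>\<close>. The case distinction is needed because \<open>0 powr 0 = 0\<close> in the
  library, whereas the second factor is \<open>1\<close> for \<open>\<zeta> = 1\<close> by convention.\<close>

definition zeta_const :: "real \<Rightarrow> real" where
  "zeta_const \<zeta> = \<zeta> powr \<zeta> * (if \<zeta> = 1 then 1 else (1 - \<zeta>) powr (1 - \<zeta>))"

definition gam :: "real \<Rightarrow> real \<Rightarrow> real \<Rightarrow> 'a::real_normed_vector \<Rightarrow> (real \<Rightarrow> real)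
    \<Rightarrow> real \<Rightarrow> real" where
  "gam N1 N2 \<zeta> v \<epsilon> t =
     1 - 1/2 * \<epsilon> t powr (\<zeta> - 1/2) * N2 * zeta_const \<zeta> * norm v
       - N1 powr (2 * (\<zeta> + 1/2)) * N2 * norm v / (N1\<^sup>2 + \<epsilon> t)"

text \<open>Only the values of \<open>z\<close> on \<open>[0, \<infinity>)\<close> matter; the derivative at \<open>0\<close> is one-sided.\<close>

definition solves_cauchy ::
    "('a::real_normed_vector \<Rightarrow> real \<Rightarrow> 'a) \<Rightarrow> 'a \<Rightarrow> (real \<Rightarrow> 'a) \<Rightarrow> bool" where
  "solves_cauchy f z0 z \<longleftrightarrow>
     z 0 = z0 \<and> (\<forall>t\<ge>0. (z has_vector_derivative f (z t) t) (at t within {0..}))"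

end

theory Submission
  imports Defs
begin

text \<open>Write \<open>w = z - y\<close>. Expanding \<open>F\<close> to first order at \<open>z\<close> turns the equation into \<open>w' = -w + p - \<epsilon> q\<close>, where
  \<open>p\<close> collects the Taylor remainder and \<open>q = T\<^sub>\<epsilon>(z)\<^sup>-\<^sup>1 T\<^sup>\<zeta>(y) v\<close>. Replacing \<open>T\<^sub>\<epsilon>(z)\<close> by \<open>T\<^sub>\<epsilon>(y)\<close> in \<open>q\<close> costs a
  multiple of \<open>norm w\<close>, and the functional calculus of \<open>T(y)\<close> bounds the rest by \<open>\<epsilon>\<^sup>\<zeta>\<close>. Hence
  \<open>u = norm w / \<epsilon>\<^sup>\<zeta>\<close> satisfies a Riccati inequality
  \<open>u' \<le> - C\<^sub>0 u + \<kappa> u\<^sup>2 / 4 + \<zeta>\<^sup>\<zeta> (1-\<zeta>)\<^sup>1\<^sup>-\<^sup>\<zeta> norm v\<close> with \<open>\<kappa> = N\<^sub>2 \<epsilon>(0)\<^bsup>\<zeta>-1/2\<^esup>\<close>, whose right-hand side is negative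
  at \<open>u = 2 C\<^sub>0 / \<kappa>\<close>; since \<open>u\<close> starts below this level, it never reaches it. The solution therefore stays in
  a fixed ball, outside of which \<open>\<Phi>\<close> may be modified to be globally Lipschitz in \<open>z\<close>.\<close>

section \<open>Adjoints and coercive operators\<close>

text \<open>The source condition concerns \<open>T(y)\<close>, while the flow inverts
  \<open>T_\<epsilon>(z)\<close>, and these operators need not commute. The exchange in
  \<open>q\<close> is the resolvent identity, with \<open>T(y) - T(z)\<close> written as the adjoint
  of \<open>F'(z)\<close> times \<open>F'(y) - F'(z)\<close>, plus the adjoint of
  \<open>F'(y) - F'(z)\<close> times \<open>F'(y)\<close>. In the first summand the adjoint of
  \<open>F'(z)\<close> next to the inverse improves \<open>1/\<epsilon>\<close> to
  \<open>1/(2 sqrt \<epsilon>)\<close>; in the second, \<open>F'(y)\<close> acts on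
  \<open>T_\<epsilon>(y)^-1 T(y)^\<zeta> v\<close>. Bounds for
  \<open>l^\<zeta>/(l+\<epsilon>)\<close> and \<open>l^(\<zeta>+1/2)/(l+\<epsilon>)\<close> then
  produce precisely the two terms subtracted in \<gamma>. They pass to operators through one fact: a
  polynomial that is nonnegative on \<open>[0, norm A]\<close> gives a nonnegative form at
  \<open>A\<close>. The level \<open>2 C0 / \<kappa>\<close> is the vertex of the Riccati parabola.
  The first half of assumption 2 says that the parabola is negative there, the second half that
  \<open>u(0)\<close> lies to the left of it.\<close>

lemma riesz_representation:
  fixes \<phi> :: "'a::{real_inner,banach} \<Rightarrow> real"
  assumes "bounded_linear \<phi>"
  shows "\<exists>r. \<forall>x. \<phi> x = x \<bullet> r"
proof -
  interpret bounded_linear \<phi> by fact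
  \<comment> \<open>If \<open>r\<close> represents \<phi>, then
    \<open>J x = (norm (x - r))\<^sup>2 / 2 - (norm r)\<^sup>2 / 2\<close>, so the representing
    vector is sought as a minimiser of \<open>J\<close>.\<close>
  define J where "J x = (norm x)\<^sup>2 / 2 - \<phi> x" for x
  have J_lower: "J x \<ge> - (onorm \<phi>)\<^sup>2 / 2" for x
  proof -
    have "\<phi> x \<le> onorm \<phi> * norm x"
      using onorm[OF assms, of x] by simp
    moreover have "0 \<le> (onorm \<phi> - norm x)\<^sup>2" by simp
    ultimately show ?thesis
      unfolding J_def power2_diff by (simp add: field_simps)
  qed
  define d where "d = Inf (range J)"
  have bdd: "bdd_below (range J)" using J_lower by (rule bdd_belowI2)
  have d_le: "d \<le> J x" for x unfolding d_def using bdd by (simp add: cInf_lower)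
  have "\<exists>x. J x < d + inverse (real (Suc n))" for n
  proof -
    have "Inf (range J) < d + inverse (real (Suc n))" unfolding d_def by simp
    then show ?thesis using cInf_lessD[of "range J"] by blast
  qed
  then obtain x where x: "\<And>n. J (x n) < d + inverse (real (Suc n))" by metis
  \<comment> \<open>\<open>J\<close> at the midpoint is not below the infimum \<open>d\<close>, so
    two almost minimal points must be close together: this makes \<open>x\<close> a Cauchy
    sequence.\<close>
  have parallelogram: "(norm (a - b))\<^sup>2 = 4 * (J a + J b - 2 * J ((1/2) *\<^sub>R (a + b)))" for a b
    unfolding J_def scaleR add power2_norm_eq_inner
    by (simp add: inner_diff inner_add inner_commute) (simp add: field_simps)
  have dist_bound: "(norm (x i - x j))\<^sup>2 \<le> 8 * inverse (real (Suc n))"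
    if "n \<le> i" "n \<le> j" for n i j
  proof -
    have "J (x k) \<le> d + inverse (real (Suc n))" if "n \<le> k" for k
    proof -
      have "inverse (real (Suc k)) \<le> inverse (real (Suc n))"
        using that by (intro le_imp_inverse_le) auto
      then show ?thesis using x[of k] by linarith
    qed
    then have "J (x i) \<le> d + inverse (real (Suc n))" "J (x j) \<le> d + inverse (real (Suc n))"
      using that by auto
    then show ?thesis
      unfolding parallelogram using d_le[of "(1/2) *\<^sub>R (x i + x j)"] by simp
  qed
  have "Cauchy x"
  proof (rule CauchyI)
    fix e :: real assume "e > 0"
    then obtain n where n: "inverse (real (Suc n)) < e\<^sup>2 / 8"
      using reals_Archimedean[of "e\<^sup>2 / 8"] by auto
    show "\<exists>M. \<forall>m\<ge>M. \<forall>n\<ge>M. norm (x m - x n) < e"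
    proof (intro exI allI impI)
      fix i j assume "n \<le> i" "n \<le> j"
      then have "(norm (x i - x j))\<^sup>2 < e\<^sup>2" using dist_bound[of n i j] n by simp
      then show "norm (x i - x j) < e" using \<open>e > 0\<close> by (simp add: power_less_imp_less_base)
    qed
  qed
  then obtain r where r: "x \<longlonglongrightarrow> r" using Cauchy_convergent convergent_def by blast
  have "(\<lambda>n. J (x n)) \<longlonglongrightarrow> J r"
    unfolding J_def by (intro tendsto_intros tendsto r) auto
  moreover have "(\<lambda>n. d + inverse (real (Suc n))) \<longlonglongrightarrow> d + 0"
    by (intro tendsto_add tendsto_const LIMSEQ_inverse_real_of_nat)
  ultimately have "J r \<le> d + 0"
    by (rule LIMSEQ_le) (use x less_imp_le in blast)
  then have minimal: "J r \<le> J a" for a using d_le[of a] by simp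
  have "\<phi> a = a \<bullet> r" for a
  proof -
    define c where "c = a \<bullet> r - \<phi> a"
    have quad: "0 \<le> s * c + s\<^sup>2 * (norm a)\<^sup>2 / 2" for s
    proof -
      have "J (r + s *\<^sub>R a) - J r = s * c + s\<^sup>2 * (norm a)\<^sup>2 / 2"
        unfolding J_def c_def scaleR add power2_norm_eq_inner
        by (simp add: inner_add inner_commute power2_eq_square) (simp add: field_simps)
      then show ?thesis using minimal[of "r + s *\<^sub>R a"] by simp
    qed
    \<comment> \<open>The quadratic in \<open>s\<close> is least at
      \<open>s = - c / (norm a)\<^sup>2\<close>; adding \<open>1\<close> keeps the denominator
      positive for \<open>a = 0\<close> and still leaves a strictly negative value unless
      \<open>c = 0\<close>.\<close>
    define k where "k = 1 + (norm a)\<^sup>2"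
    have k: "k > 0" unfolding k_def by (simp add: add_pos_nonneg)
    have "0 \<le> (- (c / k)) * c + (- (c / k))\<^sup>2 * (norm a)\<^sup>2 / 2" by (rule quad)
    also have "\<dots> \<le> (- (c / k)) * c + (- (c / k))\<^sup>2 * k / 2"
      unfolding k_def by (intro add_left_mono divide_right_mono mult_left_mono) auto
    also have "\<dots> = - (c\<^sup>2 / (2 * k))" using k by (simp add: field_simps power2_eq_square)
    finally have "c\<^sup>2 / (2 * k) \<le> 0" by simp
    then have "c = 0" using k by (simp add: field_simps mult_le_0_iff)
    then show ?thesis by (simp add: c_def)
  qed
  then show ?thesis by blast
qed

text \<open>Riesz representation provides a candidate for the choice in \<open>adjoint\<close>;
  testing with the adjoint vector itself gives boundedness, after which the coercion
  \<open>Blinfun\<close> is faithful.\<close>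

lemma inner_blinfun_adjoint:
  fixes A :: "'a::{real_inner,banach} \<Rightarrow>\<^sub>L 'b::{real_inner,banach}"
  shows "blinfun_apply A x \<bullet> u = x \<bullet> blinfun_apply (blinfun_adjoint A) u"
proof -
  have "\<exists>r. \<forall>x. A x \<bullet> u = x \<bullet> r" for u
    by (rule riesz_representation)
      (intro bounded_linear_compose[OF bounded_linear_inner_left] blinfun.bounded_linear_right)
  then have "\<exists>f'. \<forall>x u. A x \<bullet> u = x \<bullet> f' u" by metis
  then have "\<forall>x u. A x \<bullet> u = x \<bullet> adjoint (blinfun_apply A) u"
    unfolding adjoint_def by (rule someI_ex)
  then have adj: "A x \<bullet> u = x \<bullet> adjoint (blinfun_apply A) u" for x u by blast
  have eqI: "a = b" if "\<And>x. x \<bullet> a = x \<bullet> b" for a b :: 'a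
    by (rule vector_eq_ldot[THEN iffD1]) (use that in blast)
  have "bounded_linear (adjoint (blinfun_apply A))"
  proof (rule bounded_linear_intro[where K = "norm A"])
    show "adjoint A (a + b) = adjoint A a + adjoint A b" for a b
      by (rule eqI) (simp add: adj[symmetric] inner_add_right)
    show "adjoint A (c *\<^sub>R a) = c *\<^sub>R adjoint A a" for c a
      by (rule eqI) (simp add: adj[symmetric])
    show "norm (adjoint A a) \<le> norm a * norm A" for a
    proof -
      let ?b = "adjoint (blinfun_apply A) a"
      have "(norm ?b)\<^sup>2 = A ?b \<bullet> a" unfolding adj power2_norm_eq_inner ..
      also have "\<dots> \<le> norm (A ?b) * norm a" by (rule norm_cauchy_schwarz)
      also have "\<dots> \<le> (norm A * norm ?b) * norm a" by (intro mult_right_mono norm_blinfun) auto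
      finally have "norm ?b * norm ?b \<le> norm ?b * (norm a * norm A)"
        by (simp add: power2_eq_square algebra_simps)
      then show ?thesis
        by (cases "?b = 0") (auto intro: mult_left_le_imp_le)
    qed
  qed
  then show ?thesis
    unfolding blinfun_adjoint_def by (simp add: bounded_linear_Blinfun_apply adj)
qed

lemma inner_blinfun_adjoint':
  fixes A :: "'a::{real_inner,banach} \<Rightarrow>\<^sub>L 'b::{real_inner,banach}"
  shows "blinfun_apply (blinfun_adjoint A) u \<bullet> x = u \<bullet> blinfun_apply A x"
  unfolding inner_commute[of _ x] inner_commute[of u] by (rule inner_blinfun_adjoint[symmetric])

lemma blinfun_adjoint_diff:
  "blinfun_adjoint (A - B) = blinfun_adjoint A - blinfun_adjoint B"
proof (rule blinfun_eqI)
  fix u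
  have "x \<bullet> blinfun_adjoint (A - B) u = x \<bullet> (blinfun_adjoint A - blinfun_adjoint B) u" for x
    by (simp add: inner_blinfun_adjoint[symmetric] blinfun.diff_left inner_diff_left inner_diff_right)
  then show "blinfun_adjoint (A - B) u = (blinfun_adjoint A - blinfun_adjoint B) u"
    by (rule vector_eq_ldot[THEN iffD1, OF allI])
qed

lemma norm_blinfun_adjoint_le: "norm (blinfun_adjoint A) \<le> norm A"
proof (rule norm_blinfun_bound)
  fix u
  let ?b = "blinfun_adjoint A u"
  have "(norm ?b)\<^sup>2 = A ?b \<bullet> u" unfolding inner_blinfun_adjoint power2_norm_eq_inner ..
  also have "\<dots> \<le> norm (A ?b) * norm u" by (rule norm_cauchy_schwarz)
  also have "\<dots> \<le> (norm A * norm ?b) * norm u" by (intro mult_right_mono norm_blinfun) auto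
  finally have "norm ?b * norm ?b \<le> norm ?b * (norm A * norm u)"
    by (simp add: power2_eq_square algebra_simps)
  then show "norm ?b \<le> norm A * norm u"
    by (cases "?b = 0") simp_all
qed auto

text \<open>The Lax-Milgram argument: injectivity is immediate from coercivity, and a preimage of
  \<open>b\<close> is a fixed point of \<open>x - \<alpha> (B x - b)\<close>, a contraction for
  small \<alpha>.\<close>

lemma coercive_bij:
  fixes B :: "'a::{real_inner,banach} \<Rightarrow>\<^sub>L 'a"
  assumes e: "e > 0" and coercive: "\<And>x. e * (norm x)\<^sup>2 \<le> B x \<bullet> x"
  shows "bij B"
proof (rule bijI)
  show "inj B"
  proof (rule injI)
    fix x u assume "B x = B u"
    then have "e * (norm (x - u))\<^sup>2 \<le> 0" using coercive[of "x - u"] by (simp add: blinfun.diff_right)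
    then show "x = u" using e by (simp add: mult_le_0_iff)
  qed
  define M where "M = norm B + e"
  have M: "M > 0" "M \<ge> norm B" "M \<ge> e" using e by (auto simp: M_def add_nonneg_pos)
  \<comment> \<open>Minimiser of the squared contraction factor
    \<open>1 - 2 \<alpha> e + \<alpha>\<^sup>2 M\<^sup>2\<close>, with minimum
    \<open>1 - \<alpha> e\<close>. The summand \<open>e\<close> in \<open>M\<close> ensures that
    this is nonnegative.\<close>
  define \<alpha> where "\<alpha> = e / M\<^sup>2"
  have \<alpha>: "\<alpha> > 0" using e M by (simp add: \<alpha>_def)
  have \<alpha>M: "\<alpha> * M\<^sup>2 = e" using M by (simp add: \<alpha>_def)
  define q where "q = sqrt (1 - \<alpha> * e)"
  have "e\<^sup>2 \<le> M\<^sup>2" using M e by (intro power_mono) auto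
  then have eM: "\<alpha> * e \<le> 1" using M by (simp add: \<alpha>_def power2_eq_square)
  have q: "0 \<le> q" "q < 1" using eM e \<alpha> by (auto simp: q_def)
  have contr: "norm (x - \<alpha> *\<^sub>R B x) \<le> q * norm x" for x
  proof -
    have "(norm (x - \<alpha> *\<^sub>R B x))\<^sup>2 = (norm x)\<^sup>2 - 2 * \<alpha> * (B x \<bullet> x) + \<alpha>\<^sup>2 * (norm (B x))\<^sup>2"
      unfolding power2_norm_eq_inner by (simp add: inner_diff inner_commute power2_eq_square)
    also have "\<dots> \<le> (norm x)\<^sup>2 - 2 * \<alpha> * (e * (norm x)\<^sup>2) + \<alpha>\<^sup>2 * (M * norm x)\<^sup>2"
    proof -
      have "norm (B x) \<le> M * norm x"
        using norm_blinfun[of B x] M(2) by (meson mult_right_mono norm_ge_zero order_trans)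
      then show ?thesis
        using \<alpha> coercive[of x] by (intro add_mono diff_mono mult_left_mono power_mono) auto
    qed
    also have "\<alpha>\<^sup>2 * (M * norm x)\<^sup>2 = \<alpha> * (\<alpha> * M\<^sup>2) * (norm x)\<^sup>2"
      unfolding power_mult_distrib power2_eq_square[of \<alpha>] by (simp only: mult.assoc)
    also have "(norm x)\<^sup>2 - 2 * \<alpha> * (e * (norm x)\<^sup>2) + \<alpha> * (\<alpha> * M\<^sup>2) * (norm x)\<^sup>2
        = (1 - \<alpha> * e) * (norm x)\<^sup>2"
      unfolding \<alpha>M by (simp add: left_diff_distrib)
    also have "1 - \<alpha> * e = q\<^sup>2" using eM by (simp add: q_def)
    also have "q\<^sup>2 * (norm x)\<^sup>2 = (q * norm x)\<^sup>2" by (simp only: power_mult_distrib)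
    finally show ?thesis by (rule power2_le_imp_le) (use q in simp)
  qed
  show "surj B"
    unfolding surj_def
  proof
    fix b
    define f where "f x = x - \<alpha> *\<^sub>R (B x - b)" for x
    have "\<exists>!x. f x = x"
    proof (rule banach_fix_type[OF q], intro allI)
      fix x u
      have "f x - f u = (x - u) - \<alpha> *\<^sub>R B (x - u)"
        by (simp add: f_def blinfun.diff_right algebra_simps)
      then show "dist (f x) (f u) \<le> q * dist x u"
        using contr[of "x - u"] by (simp add: dist_norm)
    qed
    then obtain x where "f x = x" by blast
    then show "\<exists>x. b = B x" using \<alpha> by (auto simp: f_def)
  qed
qed

lemma coercive_norm_le:
  fixes B :: "'a::{real_inner,banach} \<Rightarrow>\<^sub>L 'a"
  assumes e: "e > 0" and coercive: "\<And>x. e * (norm x)\<^sup>2 \<le> B x \<bullet> x"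
  shows "norm x \<le> norm (B x) / e"
proof -
  have "e * (norm x)\<^sup>2 \<le> norm (B x) * norm x"
    using coercive[of x] norm_cauchy_schwarz[of "B x" x] by simp
  then have "norm x * (e * norm x) \<le> norm x * norm (B x)" by (simp add: power2_eq_square algebra_simps)
  then have "e * norm x \<le> norm (B x)"
    by (cases "x = 0") (auto intro: mult_left_le_imp_le)
  then show ?thesis using e by (simp add: field_simps)
qed

text \<open>Subtracting the two equations gives \<open>B (x - x') = (b - b') - (B - B') x'\<close>.
  The perturbation is felt only along the known solution \<open>x'\<close>, which serves both
  continuity in time and the Lipschitz estimate for \<open>Phi\<close>.\<close>

lemma coercive_inv_diff:
  fixes B B' :: "'a::{real_inner,banach} \<Rightarrow>\<^sub>L 'a"
  assumes e: "e > 0" and coercive: "\<And>x. e * (norm x)\<^sup>2 \<le> B x \<bullet> x"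
  assumes e': "e' > 0" and coercive': "\<And>x. e' * (norm x)\<^sup>2 \<le> B' x \<bullet> x"
  shows "norm (inv B b - inv B' b') \<le> (norm (b - b') + norm (B - B') * norm (inv B' b')) / e"
proof -
  let ?x = "inv B b" and ?x' = "inv B' b'"
  have x: "B ?x = b" "B' ?x' = b'"
    using coercive_bij[OF e coercive] coercive_bij[OF e' coercive'] by (auto simp: bij_def surj_f_inv_f)
  have "B (?x - ?x') = (b - b') - (B - B') ?x'"
    by (simp add: blinfun.diff_right blinfun.diff_left x)
  then have "norm (B (?x - ?x')) \<le> norm (b - b') + norm ((B - B') ?x')"
    by (simp add: norm_triangle_ineq4)
  also have "\<dots> \<le> norm (b - b') + norm (B - B') * norm ?x'"
    by (intro add_left_mono norm_blinfun)
  finally have "norm (B (?x - ?x')) / e \<le> (norm (b - b') + norm (B - B') * norm ?x') / e"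
    using e by (simp add: divide_right_mono)
  with coercive_norm_le[OF e coercive, of "?x - ?x'"] show ?thesis by (rule order_trans)
qed

section \<open>Polynomials of a positive operator\<close>

text \<open>After a linear factor is divided out, the sign of the quotient is known only off the
  root; continuity supplies it there.\<close>

lemma poly_nonneg_closed:
  fixes r :: "real poly"
  assumes "a < b" "\<And>x. a < x \<Longrightarrow> x < b \<Longrightarrow> 0 \<le> poly r x" "a \<le> x" "x \<le> b"
  shows "0 \<le> poly r x"
proof (rule continuous_ge_on_closure[where S = "{a<..<b}" and f = "poly r" and x = x])
  show "x \<in> closure {a<..<b}" using assms by simp
qed (use assms in \<open>auto intro!: continuous_intros\<close>)

text \<open>The four weights make the induction on the degree close up: after subtracting its minimum, a
  polynomial loses a factor that is \<open>X\<close>, \<open>m - X\<close> or a square, and a product of two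
  weights is again a weight times a square.\<close>

lemma nonneg_poly_induct:
  fixes Q :: "real poly \<Rightarrow> bool" and m :: real
  assumes m: "m > 0"
    and add: "\<And>p q. Q p \<Longrightarrow> Q q \<Longrightarrow> Q (p + q)"
    and sq: "\<And>p q. Q p \<Longrightarrow> Q (q * q * p)"
    and weights: "Q 1" "Q [:0, 1:]" "Q [:m, -1:]" "Q ([:0, 1:] * [:m, -1:])"
    and nonneg: "\<And>x. 0 \<le> x \<Longrightarrow> x \<le> m \<Longrightarrow> 0 \<le> poly p x"
  shows "Q p"
proof -
  define X Y where "X = [:0, 1::real:]" and "Y = [:m, -1:]"
  have "Q p \<and> Q (X * p) \<and> Q (Y * p) \<and> Q (X * Y * p)"
    using nonneg
  proof (induction "degree p" arbitrary: p rule: less_induct)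
    case (less p)
    \<comment> \<open>The closure assumptions on \<open>Q\<close> contain no scalar multiplication,
      so a nonnegative constant enters as the square of \<open>[:sqrt c:]\<close>.\<close>
    have const: "Q [:c:]" "Q (X * [:c:])" "Q (Y * [:c:])" "Q (X * Y * [:c:])" if "c \<ge> 0" for c
    proof -
      have "[:sqrt c:] * [:sqrt c:] * w = w * [:c:]" for w :: "real poly"
        using that by simp
      then have "Q (w * [:c:])" if "Q w" for w using sq[OF that, of "[:sqrt c:]"] by simp
      from this[of 1] this[of X] this[of Y] this[of "X * Y"] weights
      show "Q [:c:]" "Q (X * [:c:])" "Q (Y * [:c:])" "Q (X * Y * [:c:])"
        by (simp_all only: X_def Y_def mult_1)
    qed
    show ?case
    proof (cases "degree p = 0")
      case True
      then obtain c where p: "p = [:c:]" by (metis degree_eq_zeroE)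
      have "c \<ge> 0" using less.prems[of 0] m by (simp add: p)
      then show ?thesis using const p by simp
    next
      case False
      obtain l where l: "0 \<le> l" "l \<le> m" and l_min: "\<And>x. 0 \<le> x \<Longrightarrow> x \<le> m \<Longrightarrow> poly p l \<le> poly p x"
        using continuous_attains_inf[of "{0..m}" "poly p"] m
        by (force intro: continuous_intros)
      define c where "c = poly p l"
      have c: "c \<ge> 0" using less.prems l by (simp add: c_def)
      have "poly (p - [:c:]) l = 0" by (simp add: c_def)
      then obtain r where r: "p - [:c:] = [:-l, 1:] * r"
        using poly_eq_0_iff_dvd by (metis dvdE)
      have "degree (p - [:c:]) = degree p" using False
        degree_add_eq_left[of "[:-c:]" p] by (simp add: diff_conv_add_uminus del: add_uminus_conv_diff)
      moreover have "p - [:c:] \<noteq> 0" using False calculation by auto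
      ultimately have deg: "degree p = Suc (degree r)"
        unfolding r by (subst (asm) degree_mult_eq) auto
      have fac: "(x - l) * poly r x \<ge> 0" if "0 \<le> x" "x \<le> m" for x
      proof -
        have "(x - l) * poly r x = poly p x - c"
          using arg_cong[OF r, of "\<lambda>q. poly q x"] by (simp add: left_diff_distrib)
        then show ?thesis using l_min[OF that] by (simp add: c_def)
      qed
      have p: "p = [:c:] + [:-l, 1:] * r" using r by (simp add: algebra_simps)
      have split: "Q (w * p)" if "Q (w * [:c:])" "Q (w * ([:-l, 1:] * r))" for w
        unfolding p distrib_left using that by (rule add)
      have split1: "Q p" if "Q ([:-l, 1:] * r)"
        using split[of 1] that const(1)[OF c] by simp
      \<comment> \<open>At an interior minimiser \<open>r\<close> passes from nonpositive to
        nonnegative, hence vanishes, and the root is double. At the right end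
        \<open>[:-l, 1:]\<close> is \<open>- Y\<close>, and the sign moves to
        \<open>r\<close>.\<close>
      consider "l = 0" | "l = m" | "0 < l" "l < m" using l by linarith
      then show ?thesis
      proof cases
        case 1
        have "0 \<le> poly r x" if "0 \<le> x" "x \<le> m" for x
        proof (rule poly_nonneg_closed[OF m _ that])
          fix x assume "0 < x" "x < m"
          then show "0 \<le> poly r x" using fac[of x] 1 by (simp add: zero_le_mult_iff)
        qed
        then have IH: "Q r" "Q (X * r)" "Q (Y * r)" "Q (X * Y * r)"
          using less.hyps[of r] deg by auto
        have lX: "[:-l, 1:] = X" using 1 by (simp add: X_def)
        have "Q (X * (X * r))" using sq[OF IH(1), of X] by (simp only: mult.assoc)
        moreover have "Q (Y * (X * r))" using IH(4) by (simp only: ac_simps)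
        moreover have "Q (X * Y * (X * r))" using sq[OF IH(3), of X] by (simp only: ac_simps)
        ultimately show ?thesis
          using split split1 const[OF c] IH unfolding lX by blast
      next
        case 2
        have "0 \<le> poly (- r) x" if "0 \<le> x" "x \<le> m" for x
        proof (rule poly_nonneg_closed[OF m _ that])
          fix x assume "0 < x" "x < m"
          then show "0 \<le> poly (- r) x" using fac[of x] 2 by (simp add: zero_le_mult_iff)
        qed
        then have IH: "Q (- r)" "Q (X * - r)" "Q (Y * - r)" "Q (X * Y * - r)"
          using less.hyps[of "- r"] deg by auto
        have lY: "[:-l, 1:] * r = Y * - r" using 2 by (simp add: Y_def)
        have "Q (X * (Y * - r))" using IH(4) by (simp only: mult.assoc)
        moreover have "Q (Y * (Y * - r))" using sq[OF IH(1), of Y] by (simp only: mult.assoc)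
        moreover have "Q (X * Y * (Y * - r))" using sq[OF IH(2), of Y] by (simp only: ac_simps)
        ultimately show ?thesis
          using split split1 const[OF c] IH unfolding lY by blast
      next
        case 3
        have "0 \<le> poly r l"
        proof (rule poly_nonneg_closed[of l m])
          show "0 \<le> poly r x" if "l < x" "x < m" for x
            using fac[of x] that l by (simp add: zero_le_mult_iff)
        qed (use 3 in auto)
        moreover have "0 \<le> poly (- r) l"
        proof (rule poly_nonneg_closed[of 0 l])
          show "0 \<le> poly (- r) x" if "0 < x" "x < l" for x
            using fac[of x] that l by (simp add: zero_le_mult_iff)
        qed (use 3 in auto)
        ultimately have "poly r l = 0" by simp
        then obtain q where q: "r = [:-l, 1:] * q"
          using poly_eq_0_iff_dvd by (metis dvdE)
        have off: "0 \<le> poly q x" if "0 \<le> x" "x \<le> m" "x \<noteq> l" for x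
        proof -
          have "(x - l)\<^sup>2 * poly q x = (x - l) * poly r x"
            by (simp add: q power2_eq_square algebra_simps)
          then have "(x - l)\<^sup>2 * poly q x \<ge> 0" using fac[of x] that by simp
          then show ?thesis using that by (simp add: zero_le_mult_iff)
        qed
        have "0 \<le> poly q x" if "0 \<le> x" "x \<le> m" for x
        proof (cases "x = l")
          case True
          show ?thesis unfolding True
            by (rule poly_nonneg_closed[of l m]) (use 3 off in auto)
        qed (use off that in auto)
        moreover have "q \<noteq> 0" using q r \<open>p - [:c:] \<noteq> 0\<close> by auto
        then have "degree r = Suc (degree q)" unfolding q by (subst degree_mult_eq) auto
        ultimately have IH: "Q q" "Q (X * q)" "Q (Y * q)" "Q (X * Y * q)"
          using less.hyps[of q] deg by auto
        have "Q (w * ([:-l, 1:] * r))" if "Q (w * q)" for w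
          using sq[OF that, of "[:-l, 1:]"] unfolding q by (simp only: ac_simps)
        from this[of X] this[of Y] this[of "X * Y"] this[of 1] IH
        have "Q (X * ([:-l, 1:] * r))" "Q (Y * ([:-l, 1:] * r))" "Q (X * Y * ([:-l, 1:] * r))"
          "Q ([:-l, 1:] * r)" by (simp_all only: mult_1)
        then show ?thesis using split split1 const[OF c] by blast
      qed
    qed
  qed
  then show ?thesis by blast
qed

lemma poly_blinfun_0 [simp]: "poly_blinfun 0 A = 0"
  by (simp add: poly_blinfun_def)

text \<open>Horner's rule, which replaces the degree-indexed sum by induction over
  \<open>pCons\<close>.\<close>

lemma poly_blinfun_pCons:
  "poly_blinfun (pCons a p) A = a *\<^sub>R id_blinfun + (A o\<^sub>L poly_blinfun p A)"
proof (cases "p = 0")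
  case True
  then show ?thesis by (simp add: poly_blinfun_def)
next
  case False
  interpret bounded_linear "(o\<^sub>L) A"
    by (rule bounded_bilinear.bounded_linear_right[OF bounded_bilinear_blinfun_compose])
  from False show ?thesis
    by (simp add: poly_blinfun_def degree_pCons_eq sum.atMost_Suc_shift sum scaleR
        del: sum.atMost_Suc)
qed

lemma poly_blinfun_apply_pCons:
  "poly_blinfun (pCons a p) A x = a *\<^sub>R x + A (poly_blinfun p A x)"
  by (simp add: poly_blinfun_pCons blinfun.add_left blinfun.scaleR_left)

lemma poly_blinfun_add: "poly_blinfun (p + q) A = poly_blinfun p A + poly_blinfun q A"
  by (induction p q rule: poly_induct2)
    (auto intro!: blinfun_eqI simp: poly_blinfun_apply_pCons blinfun.bilinear_simps algebra_simps)

lemma poly_blinfun_smult: "poly_blinfun (smult c p) A = c *\<^sub>R poly_blinfun p A"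
  by (induction p)
    (auto intro!: blinfun_eqI simp: poly_blinfun_apply_pCons blinfun.bilinear_simps algebra_simps)

lemma poly_blinfun_diff: "poly_blinfun (p - q) A = poly_blinfun p A - poly_blinfun q A"
  using poly_blinfun_add[of p "smult (-1) q" A] unfolding poly_blinfun_smult by simp

lemma poly_blinfun_apply_mult:
  "poly_blinfun (p * q) A x = poly_blinfun p A (poly_blinfun q A x)"
  by (induction p)
    (simp_all add: mult_pCons_left poly_blinfun_add poly_blinfun_smult poly_blinfun_apply_pCons
      blinfun.bilinear_simps)

definition positive_blinfun :: "('a::real_inner \<Rightarrow>\<^sub>L 'a) \<Rightarrow> bool" where
  "positive_blinfun A \<longleftrightarrow> (\<forall>x y. A x \<bullet> y = x \<bullet> A y) \<and> (\<forall>x. 0 \<le> A x \<bullet> x)"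

lemma inner_poly_blinfun:
  assumes "positive_blinfun A"
  shows "poly_blinfun p A x \<bullet> y = x \<bullet> poly_blinfun p A y"
proof (induction p arbitrary: x y)
  case (pCons a p)
  have "A (poly_blinfun p A x) \<bullet> y = poly_blinfun p A x \<bullet> A y"
    using assms by (simp add: positive_blinfun_def)
  also have "\<dots> = x \<bullet> poly_blinfun (p * [:0, 1:]) A y"
    by (simp only: pCons.IH poly_blinfun_apply_mult) (simp add: poly_blinfun_apply_pCons)
  also have "p * [:0, 1:] = pCons 0 p" by simp
  finally show ?case by (simp add: poly_blinfun_apply_pCons inner_add)
qed simp

text \<open>The weights of \<open>nonneg_poly_induct\<close> are positive at \<open>A\<close>
  because \<open>0 \<le> A \<le> norm A\<close> as forms, and a factor \<open>q * q\<close> only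
  replaces \<open>x\<close> by \<open>q(A) x\<close>.\<close>

lemma poly_blinfun_nonneg:
  assumes A: "positive_blinfun A"
    and nonneg: "\<And>l. 0 \<le> l \<Longrightarrow> l \<le> norm A \<Longrightarrow> 0 \<le> poly p l"
  shows "0 \<le> poly_blinfun p A x \<bullet> x"
proof (cases "A = 0")
  \<comment> \<open>The interval degenerates to a point, whereas the induction works on one of
    positive length; only the constant coefficient survives.\<close>
  case True
  obtain a q where p: "p = pCons a q" by (metis pCons_cases)
  have "a \<ge> 0" using nonneg[of 0] by (simp add: p)
  then show ?thesis by (simp add: p poly_blinfun_apply_pCons True)
next
  case False
  define m where "m = norm A"
  have m: "m > 0" using False by (simp add: m_def)
  have norm_A: "A x \<bullet> x \<le> m * (norm x)\<^sup>2" for x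
  proof -
    have "A x \<bullet> x \<le> norm (A x) * norm x" by (rule norm_cauchy_schwarz)
    also have "\<dots> \<le> m * norm x * norm x" unfolding m_def by (intro mult_right_mono norm_blinfun) auto
    finally show ?thesis by (simp add: power2_eq_square)
  qed
  have sym: "A x \<bullet> y = x \<bullet> A y" and pos: "0 \<le> A x \<bullet> x" for x y
    using A by (auto simp: positive_blinfun_def)
  have "\<forall>x. 0 \<le> poly_blinfun p A x \<bullet> x"
  proof (rule nonneg_poly_induct[OF m])
    fix p q assume "\<forall>x. 0 \<le> poly_blinfun p A x \<bullet> x"
    then show "\<forall>x. 0 \<le> poly_blinfun (q * q * p) A x \<bullet> x"
      by (simp add: mult.assoc mult.commute[of q p] poly_blinfun_apply_mult inner_poly_blinfun[OF A, of q])
  next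
    show "\<forall>x. 0 \<le> poly_blinfun 1 A x \<bullet> x"
      unfolding one_pCons by (simp add: poly_blinfun_apply_pCons)
    show "\<forall>x. 0 \<le> poly_blinfun [:0, 1:] A x \<bullet> x"
      by (simp add: poly_blinfun_apply_pCons pos)
    show "\<forall>x. 0 \<le> poly_blinfun [:m, -1:] A x \<bullet> x"
      using norm_A by (simp add: poly_blinfun_apply_pCons inner_diff_left power2_norm_eq_inner blinfun.minus_right)
    \<comment> \<open>The product weight at \<open>A\<close> amounts to
      \<open>A\<^sup>2 \<le> m A\<close>. This follows from positivity of \<open>A\<close> at
      \<open>x - A x / m\<close>, the cubic term being bounded by
      \<open>m A\<^sup>2\<close>.\<close>
    have "0 \<le> m * (A x \<bullet> x) - A x \<bullet> A x" for x
    proof -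
      have "0 \<le> A (x - (1 / m) *\<^sub>R A x) \<bullet> (x - (1 / m) *\<^sub>R A x)" by (rule pos)
      also have "\<dots> = A x \<bullet> x - 2 / m * (A x \<bullet> A x) + (1 / m)\<^sup>2 * (A (A x) \<bullet> A x)"
        by (simp add: blinfun.diff_right blinfun.scaleR_right inner_diff sym[of "A x" x]
            power2_eq_square diff_divide_distrib)
      also have "\<dots> \<le> A x \<bullet> x - 2 / m * (A x \<bullet> A x) + (1 / m)\<^sup>2 * (m * (A x \<bullet> A x))"
        using norm_A[of "A x"] by (intro add_left_mono mult_left_mono) (auto simp: power2_norm_eq_inner)
      also have "\<dots> = A x \<bullet> x - (A x \<bullet> A x) / m" using m by (simp add: power2_eq_square)
      finally show ?thesis using m by (simp add: field_simps)
    qed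
    then show "\<forall>x. 0 \<le> poly_blinfun ([:0, 1:] * [:m, -1:]) A x \<bullet> x"
      unfolding poly_blinfun_apply_mult
      by (simp add: poly_blinfun_apply_pCons inner_diff_left blinfun.bilinear_simps sym[of "A _" _])
  qed (use nonneg in \<open>auto simp: m_def poly_blinfun_add blinfun.add_left inner_add_left\<close>)
  then show ?thesis by blast
qed

text \<open>Positivity of \<open>M\<^sup>2 - p\<^sup>2\<close> at \<open>A\<close> is the squared
  norm estimate. It is what extends evaluation at \<open>A\<close> from polynomials to their uniform
  limits on \<open>[0, norm A]\<close>.\<close>

lemma norm_poly_blinfun_le:
  assumes A: "positive_blinfun A" and "M \<ge> 0"
    and M: "\<And>l. 0 \<le> l \<Longrightarrow> l \<le> norm A \<Longrightarrow> \<bar>poly p l\<bar> \<le> M"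
  shows "norm (poly_blinfun p A) \<le> M"
proof (rule norm_blinfun_bound[OF \<open>M \<ge> 0\<close>])
  fix x
  have "0 \<le> poly_blinfun ([:M\<^sup>2:] - p * p) A x \<bullet> x"
  proof (rule poly_blinfun_nonneg[OF A])
    fix l assume "0 \<le> l" "l \<le> norm A"
    then have "(poly p l)\<^sup>2 \<le> M\<^sup>2" using power_mono[OF M[of l], of 2] by simp
    then show "0 \<le> poly ([:M\<^sup>2:] - p * p) l" by (simp add: power2_eq_square)
  qed
  then have "poly_blinfun p A x \<bullet> poly_blinfun p A x \<le> M\<^sup>2 * (x \<bullet> x)"
    by (simp add: poly_blinfun_diff poly_blinfun_apply_mult blinfun.diff_left inner_diff_left
        poly_blinfun_apply_pCons inner_poly_blinfun[OF A, of p "poly_blinfun p A x"])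
  then have "(norm (poly_blinfun p A x))\<^sup>2 \<le> (M * norm x)\<^sup>2"
    by (simp add: power_mult_distrib power2_norm_eq_inner)
  then show "norm (poly_blinfun p A x) \<le> M * norm x"
    by (rule power2_le_imp_le) (use \<open>M \<ge> 0\<close> in simp)
qed

section \<open>Fractional powers of a positive operator\<close>

lemma poly_uniform_approx:
  fixes f :: "real \<Rightarrow> real"
  assumes "continuous_on {0..m} f"
  obtains p where "uniform_limit {0..m} (\<lambda>n. poly (p n)) f sequentially"
proof -
  obtain g where g: "uniform_limit {0..m} g f sequentially" "\<And>n. polynomial_function (g n)"
    using Stone_Weierstrass_uniform_limit[of "{0..m}" f] assms by auto
  have "\<exists>p. g n = poly p" for n
  proof -
    obtain a k where "g n = (\<lambda>x. \<Sum>i\<le>k. a i * x ^ i)"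
      using g(2)[of n] by (auto simp: real_polynomial_function_eq[symmetric] real_polynomial_function_iff_sum)
    then have "g n = poly (\<Sum>i\<le>k. monom (a i) i)"
      by (simp add: fun_eq_iff poly_sum poly_monom)
    then show ?thesis ..
  qed
  then obtain p where "\<And>n. g n = poly (p n)" by metis
  then have "g = (\<lambda>n. poly (p n))" by auto
  then show thesis using g(1) that by metis
qed

text \<open>Discharges the \<open>THE\<close> in \<open>blinfun_powr\<close>: evaluation at
  \<open>A\<close> is controlled by the sup norm, so the images of all approximating sequences
  converge to one limit.\<close>

lemma blinfun_powr_tendsto:
  assumes A: "positive_blinfun A" and "s > 0"
    and p: "uniform_limit {0..norm A} (\<lambda>n. poly (p n)) (\<lambda>x. x powr s) sequentially"
  shows "(\<lambda>n. poly_blinfun (p n) A) \<longlonglongrightarrow> blinfun_powr A s"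
proof -
  let ?I = "{0..norm A}"
  let ?lim = "\<lambda>p. uniform_limit ?I (\<lambda>n. poly (p n)) (\<lambda>x. x powr s) sequentially"
  \<comment> \<open>Taken for two sequences at once: with \<open>p\<close> twice it gives the Cauchy
    property, with different ones a common limit.\<close>
  have close: "\<exists>N. \<forall>n\<ge>N. \<forall>k\<ge>N. norm (poly_blinfun (p n) A - poly_blinfun (q k) A) < e"
    if lim: "?lim p" "?lim q" and "e > 0" for p q :: "nat \<Rightarrow> real poly" and e
  proof -
    have "e / 4 > 0" using that by simp
    obtain N1 where N1: "\<And>n l. n \<ge> N1 \<Longrightarrow> l \<in> ?I \<Longrightarrow> dist (poly (p n) l) (l powr s) < e / 4"
      using lim(1) \<open>e / 4 > 0\<close> unfolding uniform_limit_sequentially_iff by metis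
    obtain N2 where N2: "\<And>n l. n \<ge> N2 \<Longrightarrow> l \<in> ?I \<Longrightarrow> dist (poly (q n) l) (l powr s) < e / 4"
      using lim(2) \<open>e / 4 > 0\<close> unfolding uniform_limit_sequentially_iff by metis
    have "norm (poly_blinfun (p n) A - poly_blinfun (q k) A) \<le> e / 2"
      if "n \<ge> max N1 N2" "k \<ge> max N1 N2" for n k
      unfolding poly_blinfun_diff[symmetric]
    proof (rule norm_poly_blinfun_le[OF A])
      fix l assume "0 \<le> l" "l \<le> norm A"
      then show "\<bar>poly (p n - q k) l\<bar> \<le> e / 2"
        using N1[of n l] N2[of k l] that dist_triangle2[of "poly (p n) l" "poly (q k) l" "l powr s"]
        by (simp add: dist_real_def)
    qed (use \<open>e > 0\<close> in simp)
    then have "norm (poly_blinfun (p n) A - poly_blinfun (q k) A) < e"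
      if "n \<ge> max N1 N2" "k \<ge> max N1 N2" for n k
      using that \<open>e > 0\<close> by fastforce
    then show ?thesis by blast
  qed
  have "Cauchy (\<lambda>n. poly_blinfun (p n) A)"
    by (rule CauchyI) (rule close[OF p p])
  then obtain S where S: "(\<lambda>n. poly_blinfun (p n) A) \<longlonglongrightarrow> S"
    using Cauchy_convergent convergent_def by blast
  have all: "(\<lambda>n. poly_blinfun (q n) A) \<longlonglongrightarrow> S" if q: "?lim q" for q
  proof -
    have "(\<lambda>n. poly_blinfun (q n) A - poly_blinfun (p n) A) \<longlonglongrightarrow> 0"
    proof (rule LIMSEQ_I)
      fix e :: real assume "e > 0"
      from close[OF q p this]
      show "\<exists>N. \<forall>n\<ge>N. norm (poly_blinfun (q n) A - poly_blinfun (p n) A - 0) < e" by auto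
    qed
    from tendsto_add[OF this S] show ?thesis by simp
  qed
  have "blinfun_powr A s = S"
    unfolding blinfun_powr_def
  proof (rule the_equality)
    fix S' assume "\<forall>p. ?lim p \<longrightarrow> (\<lambda>n. poly_blinfun (p n) A) \<longlonglongrightarrow> S'"
    then show "S' = S" using p S LIMSEQ_unique by blast
  qed (use all in blast)
  then show ?thesis using S by simp
qed

text \<open>With \<open>v = (A + e) u\<close> and polynomials \<open>p\<close> close to \<open>l\<^sup>s\<close>, the left-hand side is approximated by
  \<open>(g p\<^sup>2)(A) u \<bullet> u\<close>, so that no functional calculus for rational functions is needed.\<close>

lemma resolvent_powr_bound:
  fixes A :: "'a::{real_inner,banach} \<Rightarrow>\<^sub>L 'a" and g :: "real poly"
  assumes A: "positive_blinfun A" and s: "s > 0" and e: "e > 0"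
    and x: "A x + e *\<^sub>R x = blinfun_powr A s v"
    and bound: "\<And>l. 0 \<le> l \<Longrightarrow> l \<le> norm A \<Longrightarrow> poly g l * (l powr s)\<^sup>2 \<le> (K * (l + e))\<^sup>2"
  shows "poly_blinfun g A x \<bullet> x \<le> (K * norm v)\<^sup>2"
proof -
  let ?I = "{0..norm A}"
  define B where "B = A + e *\<^sub>R id_blinfun"
  have B: "B x = A x + e *\<^sub>R x" for x
    by (simp add: B_def blinfun.add_left blinfun.scaleR_left)
  have coercive: "e * (norm x)\<^sup>2 \<le> B x \<bullet> x" for x
    using A by (auto simp: B inner_add_left power2_norm_eq_inner positive_blinfun_def)
  have B_poly: "B x = poly_blinfun [:e, 1:] A x" for x
    by (simp add: B poly_blinfun_apply_pCons)
  obtain u where u: "v = B u"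
    using coercive_bij[OF e coercive] by (meson bij_pointE)
  have cont: "continuous_on ?I (\<lambda>x. x powr s)"
    by (intro continuous_on_powr' continuous_intros) (use s in auto)
  obtain p where p: "uniform_limit ?I (\<lambda>n. poly (p n)) (\<lambda>x. x powr s) sequentially"
    using poly_uniform_approx[OF cont] by blast
  define X where "X n = poly_blinfun (p n) A u" for n
  \<comment> \<open>Polynomials in \<open>A\<close> commute with \<open>B\<close>, so
    \<open>B (X n)\<close> is seen to converge; coercivity of \<open>B\<close> carries this back to
    \<open>X n\<close>.\<close>
  have "B (X n) = poly_blinfun (p n) A v" for n
    unfolding X_def u B_poly poly_blinfun_apply_mult[symmetric] by (simp only: mult.commute)
  then have "(\<lambda>n. B (X n)) \<longlonglongrightarrow> B x"
    using blinfun.tendsto[OF blinfun_powr_tendsto[OF A s p] tendsto_const[of v]]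
    by (simp add: B x)
  then have "(\<lambda>n. norm (B (X n) - B x) / e) \<longlonglongrightarrow> norm (B x - B x) / e"
    by (intro tendsto_divide tendsto_norm tendsto_diff tendsto_const) (use e in auto)
  then have lim0: "(\<lambda>n. norm (B (X n) - B x) / e) \<longlonglongrightarrow> 0"
    unfolding diff_self norm_zero div_0 .
  have "\<forall>n. norm (X n - x) \<le> norm (B (X n) - B x) / e"
    unfolding blinfun.diff_right[symmetric] by (intro allI coercive_norm_le[OF e coercive])
  from Lim_null_comparison[OF always_eventually[OF this] lim0] have "(\<lambda>n. X n - x) \<longlonglongrightarrow> 0" .
  then have X: "X \<longlonglongrightarrow> x" by (rule LIM_zero_cancel)
  have bdd: "bounded ((\<lambda>x. x powr s) ` ?I)" "bounded (poly g ` ?I)"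
    by (auto intro!: compact_imp_bounded compact_continuous_image cont continuous_intros)
  have ulim: "uniform_limit ?I (\<lambda>n l. poly g l * (poly (p n) l * poly (p n) l))
      (\<lambda>l. poly g l * (l powr s * l powr s)) sequentially"
  proof -
    have sq: "uniform_limit ?I (\<lambda>n l. poly (p n) l * poly (p n) l) (\<lambda>l. l powr s * l powr s) sequentially"
      by (rule bounded_bilinear.bounded_uniform_limit[OF bounded_bilinear_mult p p bdd(1) bdd(1)])
    have "bounded ((\<lambda>l. l powr s * l powr s) ` ?I)"
      by (intro compact_imp_bounded compact_continuous_image continuous_on_mult cont compact_Icc)
    then show ?thesis
      by (intro bounded_bilinear.bounded_uniform_limit[OF bounded_bilinear_mult] sq
          uniform_limit_const bdd(2))
  qed
  have "poly_blinfun g A x \<bullet> x \<le> (K * norm v)\<^sup>2 + d * (norm u)\<^sup>2" if d: "d > 0" for d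
  proof (rule tendsto_upperbound)
    show "(\<lambda>n. poly_blinfun g A (X n) \<bullet> X n) \<longlonglongrightarrow> poly_blinfun g A x \<bullet> x"
      by (intro tendsto_intros X)
    have "\<forall>\<^sub>F n in sequentially. \<forall>l\<in>?I. dist (poly g l * (poly (p n) l * poly (p n) l))
        (poly g l * (l powr s * l powr s)) < d"
      using ulim d by (rule uniform_limitD)
    then show "\<forall>\<^sub>F n in sequentially. poly_blinfun g A (X n) \<bullet> X n \<le> (K * norm v)\<^sup>2 + d * (norm u)\<^sup>2"
    proof eventually_elim
      case (elim n)
      \<comment> \<open>Nonnegative on \<open>[0, norm A]\<close> by \<open>bound\<close>, with
        \<open>[:d:]\<close> absorbing the uniform error of \<open>p n\<close>. Its form at
        \<open>u\<close> is the inequality sought, since \<open>B u = v\<close>.\<close>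
      let ?h = "smult (K\<^sup>2) ([:e, 1:] * [:e, 1:]) + [:d:] - p n * (g * p n)"
      have "0 \<le> poly_blinfun ?h A u \<bullet> u"
      proof (rule poly_blinfun_nonneg[OF A])
        fix l assume l: "0 \<le> l" "l \<le> norm A"
        then have "poly g l * (poly (p n) l * poly (p n) l) \<le> poly g l * (l powr s * l powr s) + d"
          using elim by (force simp: dist_real_def)
        also have "poly g l * (l powr s * l powr s) \<le> (K * (l + e))\<^sup>2"
          using bound[OF l] by (simp add: power2_eq_square)
        finally show "0 \<le> poly ?h l" by (simp add: power2_eq_square algebra_simps)
      qed
      moreover have "poly_blinfun ?h A u
          = K\<^sup>2 *\<^sub>R B (B u) + d *\<^sub>R u - poly_blinfun (p n) A (poly_blinfun g A (X n))"
        by (simp only: poly_blinfun_diff poly_blinfun_add poly_blinfun_smult poly_blinfun_apply_mult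
            blinfun.diff_left blinfun.add_left blinfun.scaleR_left B_poly X_def)
          (simp add: poly_blinfun_apply_pCons)
      moreover have "B (B u) \<bullet> u = B u \<bullet> B u"
        unfolding B_poly by (rule inner_poly_blinfun[OF A])
      moreover have "poly_blinfun (p n) A (poly_blinfun g A (X n)) \<bullet> u = poly_blinfun g A (X n) \<bullet> X n"
        unfolding X_def by (rule inner_poly_blinfun[OF A])
      ultimately have "poly_blinfun g A (X n) \<bullet> X n \<le> K\<^sup>2 * (B u \<bullet> B u) + d * (u \<bullet> u)"
        by (simp add: inner_diff_left inner_add_left)
      then show ?case unfolding u power_mult_distrib power2_norm_eq_inner .
    qed
  qed simp
  \<comment> \<open>The vector \<open>u\<close> does not depend on \<open>d\<close>, so the error
    term vanishes as \<open>d\<close> tends to \<open>0\<close>.\<close>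
  then have "\<forall>\<^sub>F d in at_right 0. poly_blinfun g A x \<bullet> x \<le> (K * norm v)\<^sup>2 + d * (norm u)\<^sup>2"
    by (rule eventually_mono[OF eventually_at_right_less])
  moreover have "((\<lambda>d. (K * norm v)\<^sup>2 + d * (norm u)\<^sup>2) \<longlongrightarrow> (K * norm v)\<^sup>2 + 0 * (norm u)\<^sup>2) (at_right 0)"
    by (intro tendsto_add tendsto_mult tendsto_const tendsto_ident_at)
  ultimately have "poly_blinfun g A x \<bullet> x \<le> (K * norm v)\<^sup>2 + 0 * (norm u)\<^sup>2"
    by (intro tendsto_lowerbound[OF _ _ trivial_limit_at_right_real])
  then show ?thesis by simp
qed

text \<open>Weighted AM-GM for \<open>l / s\<close> and \<open>e / (1 - s)\<close>. For
  \<open>s < 1\<close>, equality at \<open>l / s = e / (1 - s)\<close> shows that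
  \<open>zeta_const s\<close> is the maximum of \<open>l powr s * e powr (1 - s) / (l + e)\<close>,
  which is the origin of the constant.\<close>

lemma zeta_const_bound:
  fixes s e l :: real
  assumes s: "0 < s" "s \<le> 1" and e: "e > 0" and l: "l \<ge> 0"
  shows "l powr s \<le> e powr (s - 1) * zeta_const s * (l + e)"
proof (cases "s = 1 \<or> l = 0")
  \<comment> \<open>For \<open>s = 1\<close> AM-GM would divide by \<open>1 - s = 0\<close>; as
    \<open>zeta_const 1 = 1\<close>, the claim there is just \<open>l \<le> l + e\<close>.\<close>
  case True
  then show ?thesis using assms by (auto simp: zeta_const_def)
next
  case False
  then have "s < 1" "l > 0" using assms by auto
  then have "(l / s) powr s * (e / (1 - s)) powr (1 - s) \<le> s * (l / s) + (1 - s) * (e / (1 - s))"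
    using s e by (intro Youngs_inequality_0) auto
  then have "l powr s * e powr (1 - s) / zeta_const s \<le> l + e"
    using False \<open>s < 1\<close> \<open>l > 0\<close> s e by (simp add: powr_divide zeta_const_def)
  moreover have "zeta_const s > 0" using False s \<open>s < 1\<close> by (simp add: zeta_const_def)
  ultimately have "l powr s * e powr (1 - s) \<le> zeta_const s * (l + e)"
    by (simp add: field_simps)
  then have "e powr (s - 1) * (l powr s * e powr (1 - s)) \<le> e powr (s - 1) * (zeta_const s * (l + e))"
    by (intro mult_left_mono) auto
  moreover have "e powr (s - 1) * (l powr s * e powr (1 - s)) = l powr s"
    using e by (simp add: mult.left_commute flip: powr_add)
  ultimately show ?thesis by (simp add: mult.assoc)
qed

text \<open>For \<open>s \<ge> 1/2\<close> the function \<open>l powr (s + 1/2) / (l + e)\<close> is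
  nondecreasing, so on \<open>[0, N\<^sup>2]\<close> it is largest at the right end. The squared
  form with a factor \<open>l\<close> fits \<open>resolvent_powr_bound\<close> for
  \<open>[:0, 1:]\<close>.\<close>

lemma sqrt_powr_bound:
  fixes N l s e :: real
  assumes N: "N > 0" and s: "s \<ge> 1/2" and e: "e > 0" and l: "0 \<le> l" "l \<le> N\<^sup>2"
  shows "l * (l powr s)\<^sup>2 \<le> (N powr (2 * (s + 1/2)) / (N\<^sup>2 + e) * (l + e))\<^sup>2"
proof (cases "l = 0")
  case False
  then have l_pos: "l > 0" using l by simp
  define a where "a = s - 1/2"
  have a: "a \<ge> 0" using s by (simp add: a_def)
  define M where "M = N\<^sup>2"
  have M: "M > 0" "l \<le> M" using N l by (auto simp: M_def)
  have N_powr: "N powr (2 * (s + 1/2)) = M * M powr a"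
  proof -
    have "N powr (2 * (s + 1/2)) = (N powr 2) powr (s + 1/2)" by (simp add: powr_powr)
    also have "N powr 2 = M" using N by (simp add: M_def)
    also have "M powr (s + 1/2) = M powr (1 + a)" by (simp add: a_def add.commute)
    also have "\<dots> = M * M powr a" using M by (simp add: powr_add)
    finally show ?thesis .
  qed
  have "sqrt l * l powr s = l powr (1/2 + s)" using l_pos by (simp add: powr_half_sqrt powr_add)
  also have "\<dots> = l powr (1 + a)" by (simp add: a_def)
  also have "\<dots> = l * l powr a" using l_pos by (simp add: powr_add)
  finally have l_powr: "sqrt l * l powr s = l * l powr a" .
  have le: "l powr a \<le> M powr a" using a l_pos M by (intro powr_mono2) auto
  have "l * l powr a * (M + e) = l * M * l powr a + e * l * l powr a" by (simp add: algebra_simps)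
  also have "\<dots> \<le> l * M * M powr a + e * M * M powr a"
    using le l_pos M e by (intro add_mono mult_mono mult_left_mono) auto
  also have "\<dots> = M * M powr a * (l + e)" by (simp add: algebra_simps)
  finally have "sqrt l * l powr s \<le> N powr (2 * (s + 1/2)) / (N\<^sup>2 + e) * (l + e)"
    unfolding l_powr N_powr M_def[symmetric] using M e by (simp add: field_simps)
  then have "(sqrt l * l powr s)\<^sup>2 \<le> (N powr (2 * (s + 1/2)) / (N\<^sup>2 + e) * (l + e))\<^sup>2"
    using l_pos by (intro power_mono) auto
  then show ?thesis using l_pos by (simp add: power_mult_distrib)
qed simp

section \<open>Cauchy problems on the half-line\<close>

lemma at_within_atLeast_eq: "at t within {0..t+1} = at t within {0::real..}"
  by (rule at_within_nhd[of t "{..<t+1}"]) auto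

lemma has_vector_derivative_integral_atLeast:
  fixes g :: "real \<Rightarrow> 'a::banach"
  assumes "continuous_on {0..} g" "t \<ge> 0"
  shows "((\<lambda>u. integral {0..u} g) has_vector_derivative g t) (at t within {0..})"
proof -
  have "continuous_on {0..t+1} g" using assms(1) by (rule continuous_on_subset) auto
  then have "((\<lambda>u. integral {0..u} g) has_vector_derivative g t) (at t within {0..t+1})"
    by (rule integral_has_vector_derivative) (use assms(2) in auto)
  then show ?thesis by (simp add: at_within_atLeast_eq)
qed

lemma nonincreasing_atLeast:
  fixes \<psi> :: "real \<Rightarrow> real"
  assumes deriv: "\<And>t. t \<ge> 0 \<Longrightarrow> (\<psi> has_real_derivative \<psi>' t) (at t within {0..})"
    and nonpos: "\<And>t. t \<ge> 0 \<Longrightarrow> \<psi>' t \<le> 0" and t: "t \<ge> 0"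
  shows "\<psi> t \<le> \<psi> 0"
proof (rule DERIV_nonpos_imp_decreasing_open[OF t])
  fix x assume x: "0 < x" "x < t"
  then have "at x within {0..} = at x" by (intro at_within_interior) simp
  then show "\<exists>y. (\<psi> has_real_derivative y) (at x) \<and> y \<le> 0"
    using deriv[of x] nonpos[of x] x by auto
next
  have "continuous_on {0..} \<psi>" using deriv by (intro DERIV_continuous_on[where D = \<psi>']) auto
  then show "continuous_on {0..t} \<psi>" by (rule continuous_on_subset) auto
qed

text \<open>At the first zero the negative derivative makes \<open>\<psi>\<close> positive just
  before it, which forces an earlier zero. A differential inequality valid only at contact is thus
  enough.\<close>

lemma barrier:
  fixes \<psi> :: "real \<Rightarrow> real"
  assumes deriv: "\<And>t. t \<ge> 0 \<Longrightarrow> (\<psi> has_real_derivative \<psi>' t) (at t within {0..})"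
    and start: "\<psi> 0 < 0" and cross: "\<And>t. t \<ge> 0 \<Longrightarrow> \<psi> t = 0 \<Longrightarrow> \<psi>' t < 0" and t: "t \<ge> 0"
  shows "\<psi> t < 0"
proof (rule ccontr)
  assume contra: "\<not> \<psi> t < 0"
  have cont: "continuous_on {0..} \<psi>" using deriv by (intro DERIV_continuous_on[where D = \<psi>']) auto
  define Z where "Z = {s \<in> {0..t}. \<psi> s = 0}"
  have "continuous_on {0..t} \<psi>" using cont by (rule continuous_on_subset) auto
  with IVT'[of \<psi> 0 0 t] have "\<exists>s\<ge>0. s \<le> t \<and> \<psi> s = 0" using start contra t by simp
  then have ne: "Z \<noteq> {}" by (auto simp: Z_def)
  have "compact Z"
  proof -
    have "closed Z" unfolding Z_def
      by (rule continuous_closed_preimage_constant) (use \<open>continuous_on {0..t} \<psi>\<close> in auto)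
    moreover have "bounded Z" by (rule bounded_subset[of "{0..t}"]) (auto simp: Z_def)
    ultimately show ?thesis by (simp add: compact_eq_bounded_closed)
  qed
  from compact_attains_inf[OF this ne]
  obtain a where a: "a \<in> Z" "\<And>s. s \<in> Z \<Longrightarrow> a \<le> s" by metis
  then have a0: "a \<ge> 0" "a \<le> t" "\<psi> a = 0" by (auto simp: Z_def)
  then have "a \<noteq> 0" using start by auto
  then have "a > 0" using a0 by simp
  obtain d where d: "d > 0" "\<And>h. h > 0 \<Longrightarrow> a - h \<in> {0..} \<Longrightarrow> h < d \<Longrightarrow> \<psi> a < \<psi> (a - h)"
    using has_real_derivative_neg_dec_left[OF deriv[OF a0(1)] cross[OF a0(1,3)]] by blast
  \<comment> \<open>\<open>min a\<close> keeps the point in the half-line, \<open>d / 2\<close>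
    keeps it strictly within the distance where \<open>d\<close> applies.\<close>
  define b where "b = a - min a (d / 2)"
  have b: "0 \<le> b" "b < a" "\<psi> b > 0"
    using d(2)[of "min a (d / 2)"] d(1) \<open>a > 0\<close> a0 by (auto simp: b_def)
  have "continuous_on {0..b} \<psi>" using cont by (rule continuous_on_subset) auto
  with IVT'[of \<psi> 0 0 b] have "\<exists>s\<ge>0. s \<le> b \<and> \<psi> s = 0" using start b by simp
  then obtain s where "0 \<le> s" "s \<le> b" "\<psi> s = 0" by blast
  then have "s \<in> Z" using b a0 by (simp add: Z_def)
  then show False using a(2) b \<open>s \<le> b\<close> by fastforce
qed

lemma solves_cauchyD:
  assumes "solves_cauchy f z0 z"
  shows "z 0 = z0" "\<And>t. t \<ge> 0 \<Longrightarrow> (z has_vector_derivative f (z t) t) (at t within {0..})"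
  using assms by (auto simp: solves_cauchy_def)

lemma has_real_derivative_exp_integral:
  fixes L :: "real \<Rightarrow> real"
  assumes "continuous_on {0..} L" "t \<ge> 0"
  shows "((\<lambda>t. exp (c * integral {0..t} L)) has_real_derivative c * L t * exp (c * integral {0..t} L))
    (at t within {0..})"
proof -
  have "((\<lambda>u. integral {0..u} L) has_real_derivative L t) (at t within {0..})"
    using has_vector_derivative_integral_atLeast[OF assms]
    by (simp add: has_real_derivative_iff_has_vector_derivative)
  then show ?thesis by (auto intro!: derivative_eq_intros)
qed

lemma has_real_derivative_norm_power2:
  assumes "(x has_vector_derivative x') (at t within S)"
  shows "((\<lambda>t. (norm (x t))\<^sup>2) has_real_derivative 2 * (x t \<bullet> x')) (at t within S)"
proof -
  have "((\<lambda>t. x t \<bullet> x t) has_derivative (\<lambda>h. x t \<bullet> h *\<^sub>R x' + h *\<^sub>R x' \<bullet> x t)) (at t within S)"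
    using assms unfolding has_vector_derivative_def by (intro has_derivative_inner) auto
  then show ?thesis
    unfolding has_field_derivative_def power2_norm_eq_inner
    by (rule has_derivative_eq_rhs) (auto simp: inner_commute fun_eq_iff)
qed

text \<open>Gronwall: with the integrating factor the squared distance is nonincreasing from
  \<open>0\<close>. \<open>L\<close> may grow with time, as the Lipschitz bound for
  \<open>Phi\<close> does when \<epsilon> tends to \<open>0\<close>.\<close>

lemma solves_cauchy_unique:
  fixes f :: "'a::real_inner \<Rightarrow> real \<Rightarrow> 'a"
  assumes L: "continuous_on {0..} L"
    and lip: "\<And>t x y. t \<ge> 0 \<Longrightarrow> norm (f x t - f y t) \<le> L t * norm (x - y)"
    and z: "solves_cauchy f z0 z" and w: "solves_cauchy f z0 w" and t: "t \<ge> 0"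
  shows "z t = w t"
proof -
  define E where "E t = exp (- 2 * integral {0..t} L)" for t
  define d where "d t = z t - w t" for t
  have "(norm (d t))\<^sup>2 * E t \<le> (norm (d 0))\<^sup>2 * E 0"
  proof (rule nonincreasing_atLeast[OF _ _ t])
    fix t :: real assume t: "t \<ge> 0"
    have "(d has_vector_derivative f (z t) t - f (w t) t) (at t within {0..})"
      unfolding d_def using t by (intro has_vector_derivative_diff solves_cauchyD[OF z] solves_cauchyD[OF w])
    from DERIV_mult[OF has_real_derivative_norm_power2[OF this] has_real_derivative_exp_integral[OF L t, of "-2"]]
    show "((\<lambda>t. (norm (d t))\<^sup>2 * E t) has_real_derivative
        (2 * (d t \<bullet> (f (z t) t - f (w t) t)) - 2 * L t * (norm (d t))\<^sup>2) * E t) (at t within {0..})"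
      unfolding E_def by (rule DERIV_cong) (simp add: algebra_simps)
    have "d t \<bullet> (f (z t) t - f (w t) t) \<le> norm (d t) * norm (f (z t) t - f (w t) t)"
      by (rule norm_cauchy_schwarz)
    also have "\<dots> \<le> norm (d t) * (L t * norm (d t))"
      unfolding d_def by (intro mult_left_mono lip t) auto
    finally show "(2 * (d t \<bullet> (f (z t) t - f (w t) t)) - 2 * L t * (norm (d t))\<^sup>2) * E t \<le> 0"
      by (intro mult_nonpos_nonneg) (auto simp: E_def power2_eq_square ac_simps)
  qed
  also have "d 0 = 0" by (simp add: d_def solves_cauchyD[OF z] solves_cauchyD[OF w])
  finally have "(norm (d t))\<^sup>2 * E t \<le> 0" by simp
  moreover have "E t > 0" by (simp add: E_def)
  ultimately have "d t = 0" by (simp add: mult_le_0_iff)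
  then show ?thesis by (simp add: d_def)
qed

text \<open>Weighting by \<open>exp (2 \<integral> L)\<close> makes the Picard map a contraction on the whole half-line, so no
  continuation of local solutions is needed.\<close>

lemma solves_cauchy_exists:
  fixes f :: "'a::banach \<Rightarrow> real \<Rightarrow> 'a"
  assumes cont: "\<And>z. continuous_on {0..} z \<Longrightarrow> continuous_on {0..} (\<lambda>t. f (z t) t)"
    and L: "continuous_on {0..} L" "\<And>t. t \<ge> 0 \<Longrightarrow> 0 \<le> L t"
    and lip: "\<And>t x y. t \<ge> 0 \<Longrightarrow> norm (f x t - f y t) \<le> L t * norm (x - y)"
    and init: "\<And>t. t \<ge> 0 \<Longrightarrow> norm (f z0 t) \<le> L t"
  shows "\<exists>z. solves_cauchy f z0 z"
proof -
  define W where "W t = exp (2 * integral {0..t} L)" for t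
  have W_deriv: "(W has_real_derivative 2 * L t * W t) (at t within {0..})" if "t \<ge> 0" for t
    unfolding W_def by (rule has_real_derivative_exp_integral[OF L(1) that])
  have W_cont: "continuous_on {0..} W"
    by (rule DERIV_continuous_on) (use W_deriv in auto)
  have W_ge_1: "W t \<ge> 1" if "t \<ge> 0" for t
  proof -
    have "L integrable_on {0..t}"
      by (intro integrable_continuous_real continuous_on_subset[OF L(1)]) auto
    then have "integral {0..t} L \<ge> 0" by (intro integral_nonneg) (use L(2) in auto)
    then show ?thesis by (simp add: W_def)
  qed
  have LW: "continuous_on {0..} (\<lambda>s. L s * W s)"
    by (intro continuous_intros L W_cont)
  \<comment> \<open>Since \<open>L * W\<close> is half the derivative of \<open>W\<close>,
    integration gains a factor \<open>1/2\<close>: the contraction constant below.\<close>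
  have weighted: "norm (integral {0..t} g) \<le> c / 2 * W t"
    if t: "t \<ge> 0" and c: "c \<ge> 0" and g: "continuous_on {0..} g"
      and bound: "\<And>s. s \<ge> 0 \<Longrightarrow> norm (g s) \<le> c * (L s * W s)" for t c and g :: "real \<Rightarrow> 'a"
  proof -
    have FTC: "((\<lambda>s. L s * W s) has_integral W t / 2 - W 0 / 2) {0..t}"
    proof (rule fundamental_theorem_of_calculus[OF t])
      fix s assume "s \<in> {0..t}"
      then have "((\<lambda>s. W s / 2) has_real_derivative 2 * L s * W s / 2) (at s within {0..})"
        by (intro DERIV_cdivide W_deriv) auto
      then have "((\<lambda>s. W s / 2) has_real_derivative L s * W s) (at s within {0..})" by simp
      then have "((\<lambda>s. W s / 2) has_real_derivative L s * W s) (at s within {0..t})"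
        by (rule has_field_derivative_subset) auto
      then show "((\<lambda>s. W s / 2) has_vector_derivative L s * W s) (at s within {0..t})"
        by (simp add: has_real_derivative_iff_has_vector_derivative)
    qed
    have "norm (integral {0..t} g) \<le> integral {0..t} (\<lambda>s. c * (L s * W s))"
    proof (rule integral_norm_bound_integral)
      show "g integrable_on {0..t}"
        by (intro integrable_continuous_real continuous_on_subset[OF g]) auto
      show "(\<lambda>s. c * (L s * W s)) integrable_on {0..t}"
        by (intro integrable_continuous_real continuous_on_subset[OF continuous_on_mult_left[OF LW]]) auto
    qed (use bound in auto)
    also have "\<dots> = c * (W t / 2 - W 0 / 2)" using FTC by (simp add: integral_unique)
    also have "\<dots> \<le> c / 2 * W t"
      using c W_ge_1[of 0] by (simp add: algebra_simps)
    finally show ?thesis .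
  qed
  \<comment> \<open>The unknown is \<open>u = (z - z0) / W\<close>, so that growth of order
    \<open>W\<close> is encoded in the complete space of bounded continuous functions.\<close>
  define Y where "Y u t = z0 + W t *\<^sub>R apply_bcontfun u t" for u :: "real \<Rightarrow>\<^sub>C 'a" and t
  have Y_cont: "continuous_on {0..} (Y u)" for u
    unfolding Y_def by (intro continuous_intros W_cont continuous_on_apply_bcontfun)
  define g where "g u s = f (Y u s) s" for u s
  have g_cont: "continuous_on {0..} (g u)" for u
    unfolding g_def by (intro cont Y_cont)
  have int_cont: "continuous_on {0..} (\<lambda>t. integral {0..t} (g u))" for u
    unfolding continuous_on_eq_continuous_within
    using has_vector_derivative_continuous[OF has_vector_derivative_integral_atLeast[OF g_cont[of u]]]
    by simp
  \<comment> \<open>Elements of that space live on the whole line; \<open>max 0 t\<close> extends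
    the Picard map constantly to negative times.\<close>
  define k where "k u t = (1 / W (max 0 t)) *\<^sub>R integral {0..max 0 t} (g u)" for u t
  have k: "k u \<in> bcontfun" for u
  proof (rule bcontfun_normI)
    have "W (max 0 t) \<noteq> 0" for t using W_ge_1[of "max 0 t"] by auto
    moreover have "continuous_on UNIV (\<lambda>t. W (max 0 t))"
      by (rule continuous_on_compose2[OF W_cont]) (auto intro!: continuous_intros)
    moreover have "continuous_on UNIV (\<lambda>t. integral {0..max 0 t} (g u))"
      by (rule continuous_on_compose2[OF int_cont]) (auto intro!: continuous_intros)
    ultimately show "continuous_on UNIV (k u)"
      unfolding k_def by (intro continuous_intros) auto
    fix t
    have "norm (integral {0..max 0 t} (g u)) \<le> (1 + norm u) / 2 * W (max 0 t)"
    proof (rule weighted[OF _ _ g_cont])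
      fix s :: real assume s: "s \<ge> 0"
      have "norm (g u s) \<le> norm (f (Y u s) s - f z0 s) + norm (f z0 s)"
        unfolding g_def by (metis diff_add_cancel norm_triangle_ineq)
      also have "\<dots> \<le> L s * norm (Y u s - z0) + L s"
        by (intro add_mono lip init s)
      also have "norm (Y u s - z0) \<le> W s * norm u"
        using W_ge_1[OF s] norm_bounded[of u s] by (simp add: Y_def)
      then have "L s * norm (Y u s - z0) + L s \<le> L s * (W s * norm u) + L s * W s"
        using L(2)[OF s] W_ge_1[OF s] mult_left_mono[of 1 "W s" "L s"]
        by (intro add_mono mult_left_mono) auto
      finally show "norm (g u s) \<le> (1 + norm u) * (L s * W s)" by (simp add: algebra_simps)
    qed auto
    then show "norm (k u t) \<le> (1 + norm u) / 2"
      using W_ge_1[of "max 0 t"] by (simp add: k_def field_simps)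
  qed
  define K where "K u = Bcontfun (k u)" for u
  have K: "apply_bcontfun (K u) t = k u t" for u t
    unfolding K_def using k by (simp add: Bcontfun_inverse)
  have "\<exists>!u. K u = u"
  proof (rule banach_fix_type[where c = "1/2"])
    show "\<forall>u v. dist (K u) (K v) \<le> 1 / 2 * dist u v"
    proof (intro allI dist_bound)
      fix u v t
      have "norm (integral {0..max 0 t} (\<lambda>s. g u s - g v s)) \<le> dist u v / 2 * W (max 0 t)"
      proof (rule weighted)
        fix s :: real assume s: "s \<ge> 0"
        have "norm (g u s - g v s) \<le> L s * norm (Y u s - Y v s)"
          unfolding g_def by (rule lip[OF s])
        also have "norm (Y u s - Y v s) = W s * dist (apply_bcontfun u s) (apply_bcontfun v s)"
          using W_ge_1[OF s] by (simp add: Y_def dist_norm flip: scaleR_diff_right)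
        also have "L s * \<dots> \<le> L s * (W s * dist u v)"
          using L(2)[OF s] W_ge_1[OF s] by (intro mult_left_mono dist_bounded) auto
        finally show "norm (g u s - g v s) \<le> dist u v * (L s * W s)" by (simp add: algebra_simps)
      qed (auto intro!: continuous_intros g_cont)
      also have "integral {0..max 0 t} (\<lambda>s. g u s - g v s)
          = integral {0..max 0 t} (g u) - integral {0..max 0 t} (g v)"
        by (intro integral_diff integrable_continuous_real continuous_on_subset[OF g_cont]) auto
      finally have int_le: "norm (integral {0..max 0 t} (g u) - integral {0..max 0 t} (g v))
          \<le> dist u v / 2 * W (max 0 t)" .
      have "dist (apply_bcontfun (K u) t) (apply_bcontfun (K v) t)
          = norm (integral {0..max 0 t} (g u) - integral {0..max 0 t} (g v)) / W (max 0 t)"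
        unfolding K k_def dist_norm scaleR_diff_right[symmetric] norm_scaleR
        using W_ge_1[of "max 0 t"] by simp
      also have "\<dots> \<le> 1/2 * dist u v"
        using int_le W_ge_1[of "max 0 t"] by (simp add: pos_divide_le_eq)
      finally show "dist (apply_bcontfun (K u) t) (apply_bcontfun (K v) t) \<le> 1/2 * dist u v" .
    qed
  qed auto
  then obtain u where u: "K u = u" by blast
  define z where "z t = z0 + integral {0..t} (g u)" for t
  have zY: "z t = Y u t" if "t \<ge> 0" for t
    using K[of u t] that W_ge_1[OF that] by (simp add: u z_def Y_def k_def max_def)
  have "solves_cauchy f z0 z"
    unfolding solves_cauchy_def
  proof (intro conjI allI impI)
    fix t :: real assume t: "t \<ge> 0"
    show "(z has_vector_derivative f (z t) t) (at t within {0..})"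
      unfolding z_def zY[OF t, unfolded z_def]
      using has_vector_derivative_add[OF has_vector_derivative_const[of z0]
          has_vector_derivative_integral_atLeast[OF g_cont[of u] t]]
      by (simp add: g_def)
  qed (simp add: z_def)
  then show ?thesis by blast
qed

section \<open>The regularized operator\<close>

lemma lipschitz_of_derivative_bound:
  fixes F :: "'a::real_normed_vector \<Rightarrow> 'b::real_normed_vector"
  assumes "\<And>x. (F has_derivative blinfun_apply (F' x)) (at x)" "\<And>x. norm (F' x) \<le> M"
  shows "norm (F x - F y) \<le> M * norm (x - y)"
  by (rule differentiable_bound[of UNIV F "\<lambda>x. blinfun_apply (F' x)"])
    (use assms in \<open>auto simp: norm_blinfun.rep_eq\<close>)

lemma taylor_remainder_bound:
  fixes F :: "'a::real_inner \<Rightarrow> 'b::real_inner" and F' :: "'a \<Rightarrow> 'a \<Rightarrow>\<^sub>L 'b"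
  assumes F': "\<And>x. (F has_derivative blinfun_apply (F' x)) (at x)"
    and lip: "\<And>x y. norm (F' x - F' y) \<le> N * norm (x - y)"
  shows "norm (F b - F a - F' a (b - a)) \<le> N / 2 * (norm (b - a))\<^sup>2"
proof -
  define d where "d = b - a"
  define u where "u = F b - F a - F' a d"
  define c where "c = N * (norm d)\<^sup>2 * norm u"
  \<comment> \<open>Testing the remainder against itself leaves a real function: the Lipschitz bound
    makes the derivative of \<open>g\<close> nonpositive, and
    \<open>g 1 - g 0 = u \<bullet> u - c / 2\<close>.\<close>
  define g where "g s = (F (a + s *\<^sub>R d) - s *\<^sub>R F' a d) \<bullet> u - c * s\<^sup>2 / 2" for s
  have deriv: "(g has_real_derivative (F' (a + s *\<^sub>R d) d - F' a d) \<bullet> u - c * s) (at s)" for s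
  proof -
    have "((\<lambda>s. a + s *\<^sub>R d) has_derivative (\<lambda>h. h *\<^sub>R d)) (at s)"
      by (auto intro!: derivative_eq_intros)
    from has_derivative_compose[OF this F']
    have "((\<lambda>s. F (a + s *\<^sub>R d)) has_derivative (\<lambda>h. F' (a + s *\<^sub>R d) (h *\<^sub>R d))) (at s)" .
    then show ?thesis
      unfolding g_def has_field_derivative_def
      by (auto intro!: derivative_eq_intros simp: blinfun.scaleR_right fun_eq_iff algebra_simps)
  qed
  have "g 1 \<le> g 0"
  proof (rule DERIV_nonpos_imp_nonincreasing[where f = g])
    fix s :: real assume s: "0 \<le> s" "s \<le> 1"
    have "(F' (a + s *\<^sub>R d) d - F' a d) \<bullet> u \<le> norm ((F' (a + s *\<^sub>R d) - F' a) d) * norm u"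
      using norm_cauchy_schwarz by (simp add: blinfun.diff_left)
    also have "\<dots> \<le> norm (F' (a + s *\<^sub>R d) - F' a) * norm d * norm u"
      by (intro mult_right_mono norm_blinfun) auto
    also have "\<dots> \<le> N * norm (a + s *\<^sub>R d - a) * norm d * norm u"
      by (intro mult_right_mono lip) auto
    also have "\<dots> = c * s" using s by (simp add: c_def power2_eq_square)
    finally show "\<exists>y. (g has_real_derivative y) (at s) \<and> y \<le> 0" using deriv by force
  qed simp
  then have "u \<bullet> u \<le> c / 2"
    by (simp add: g_def u_def d_def inner_diff_left)
  then have "norm u * norm u \<le> N / 2 * (norm d)\<^sup>2 * norm u"
    by (simp add: c_def power2_norm_eq_inner flip: power2_eq_square)
  moreover have "0 \<le> N * norm d * norm d"
    using order_trans[OF norm_ge_zero lip[of b a]] by (intro mult_nonneg_nonneg[of "N * norm d"]) (auto simp: d_def)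
  ultimately have "norm u \<le> N / 2 * (norm d)\<^sup>2"
    by (cases "u = 0") (auto simp: power2_eq_square mult.assoc)
  then show ?thesis by (simp only: u_def d_def)
qed

lemma Treg_apply: "Treg F' e h x = blinfun_adjoint (F' h) (F' h x) + e *\<^sub>R x"
  by (simp add: Treg_def Top_def blinfun.add_left blinfun.scaleR_left)

lemma inner_Top: "Top F' h x \<bullet> y = F' h x \<bullet> F' h y"
  by (simp add: Top_def inner_blinfun_adjoint')

lemma Treg_coercive: "e * (norm x)\<^sup>2 \<le> Treg F' e h x \<bullet> x"
  by (simp add: Treg_apply inner_add_left inner_blinfun_adjoint' power2_norm_eq_inner)

lemma Treg_inv: "e > 0 \<Longrightarrow> Treg F' e h (inv (Treg F' e h) b) = b"
  using coercive_bij[OF _ Treg_coercive] by (metis bij_inv_eq_iff)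

lemma inv_Treg_eqI: "e > 0 \<Longrightarrow> Treg F' e h x = b \<Longrightarrow> inv (Treg F' e h) b = x"
  using coercive_bij[OF _ Treg_coercive] by (metis bij_inv_eq_iff)

lemma norm_inv_Treg_le: "e > 0 \<Longrightarrow> norm (inv (Treg F' e h) b) \<le> norm b / e"
  using coercive_norm_le[OF _ Treg_coercive[of e _ F' h], where x = "inv (Treg F' e h) b"]
  by (simp add: Treg_inv)

lemma inv_Treg_add:
  "e > 0 \<Longrightarrow> inv (Treg F' e h) (a + b) = inv (Treg F' e h) a + inv (Treg F' e h) b"
  by (rule inv_Treg_eqI) (simp_all add: blinfun.add_right Treg_inv)

lemma inv_Treg_diff:
  "e > 0 \<Longrightarrow> inv (Treg F' e h) (a - b) = inv (Treg F' e h) a - inv (Treg F' e h) b"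
  by (rule inv_Treg_eqI) (simp_all add: blinfun.diff_right Treg_inv)

lemma inv_Treg_scaleR:
  "e > 0 \<Longrightarrow> inv (Treg F' e h) (c *\<^sub>R b) = c *\<^sub>R inv (Treg F' e h) b"
  by (rule inv_Treg_eqI) (simp_all add: blinfun.scaleR_right Treg_inv)

text \<open>Testing the equation with \<open>x\<close> gives \<open>\<bar>F' x\<bar>\<^sup>2 + e \<bar>x\<bar>\<^sup>2 \<le> \<bar>r\<bar> \<bar>F' x\<bar>\<close>,
  and \<open>a s - s\<^sup>2 \<le> a\<^sup>2 / 4\<close>.\<close>

lemma norm_inv_Treg_adjoint_le:
  assumes e: "e > 0"
  shows "norm (inv (Treg F' e h) (blinfun_adjoint (F' h) r)) \<le> norm r / (2 * sqrt e)"
proof -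
  define x where "x = inv (Treg F' e h) (blinfun_adjoint (F' h) r)"
  have "Treg F' e h x = blinfun_adjoint (F' h) r" using e by (simp add: x_def Treg_inv)
  then have "Treg F' e h x \<bullet> x = r \<bullet> F' h x" by (simp add: inner_blinfun_adjoint')
  then have "(norm (F' h x))\<^sup>2 + e * (norm x)\<^sup>2 = r \<bullet> F' h x"
    by (simp add: Treg_apply inner_add_left inner_blinfun_adjoint' power2_norm_eq_inner)
  also have "\<dots> \<le> norm r * norm (F' h x)" by (rule norm_cauchy_schwarz)
  finally have "e * (norm x)\<^sup>2 \<le> norm r * norm (F' h x) - (norm (F' h x))\<^sup>2" by simp
  also have "\<dots> \<le> (norm r)\<^sup>2 / 4"
    using zero_le_power2[of "norm r / 2 - norm (F' h x)"] by (simp add: power2_eq_square algebra_simps)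
  finally have "(sqrt e * norm x)\<^sup>2 \<le> (norm r / 2)\<^sup>2"
    using e by (simp add: power_mult_distrib power_divide)
  then have "sqrt e * norm x \<le> norm r / 2" by (rule power2_le_imp_le) simp
  then show ?thesis using e by (simp add: x_def field_simps)
qed

lemma norm_Top_le: "norm (F' h) \<le> N \<Longrightarrow> norm (Top F' h) \<le> N\<^sup>2"
proof -
  assume N: "norm (F' h) \<le> N"
  have "norm (Top F' h) \<le> norm (blinfun_adjoint (F' h)) * norm (F' h)"
    unfolding Top_def by (rule norm_blinfun_compose)
  also have "\<dots> \<le> N * N"
    using N norm_blinfun_adjoint_le[of "F' h"] order_trans[OF norm_ge_zero N] by (intro mult_mono) auto
  finally show ?thesis by (simp add: power2_eq_square)
qed

lemma norm_Top_diff_le: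
  assumes "\<And>x. norm (F' x) \<le> N"
  shows "norm (Top F' h - Top F' k) \<le> 2 * N * norm (F' h - F' k)"
proof -
  have "Top F' h - Top F' k = (blinfun_adjoint (F' h) o\<^sub>L (F' h - F' k))
      + (blinfun_adjoint (F' h - F' k) o\<^sub>L F' k)"
    by (rule blinfun_eqI)
      (simp add: Top_def blinfun.bilinear_simps blinfun_adjoint_diff)
  also have "norm \<dots> \<le> norm (blinfun_adjoint (F' h)) * norm (F' h - F' k)
      + norm (blinfun_adjoint (F' h - F' k)) * norm (F' k)"
    by (intro order_trans[OF norm_triangle_ineq] add_mono norm_blinfun_compose)
  also have "\<dots> \<le> N * norm (F' h - F' k) + norm (F' h - F' k) * N"
    using assms order_trans[OF norm_blinfun_adjoint_le assms] order_trans[OF norm_ge_zero assms]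
    by (intro add_mono mult_mono norm_blinfun_adjoint_le) auto
  finally show ?thesis by simp
qed

lemma continuous_on_blinfun_adjoint [continuous_intros]:
  fixes A :: "_ \<Rightarrow> ('a::{real_inner,banach} \<Rightarrow>\<^sub>L 'b::{real_inner,banach})"
  assumes "continuous_on S A"
  shows "continuous_on S (\<lambda>t. blinfun_adjoint (A t))"
proof -
  have "bounded_linear (blinfun_adjoint :: ('a \<Rightarrow>\<^sub>L 'b) \<Rightarrow> _)"
  proof (rule bounded_linear_intro[where K = 1])
    show "blinfun_adjoint (A + B) = blinfun_adjoint A + blinfun_adjoint B" for A B :: "'a \<Rightarrow>\<^sub>L 'b"
      using blinfun_adjoint_diff[of "A + B" B] by (simp add: algebra_simps)
    show "blinfun_adjoint (c *\<^sub>R A) = c *\<^sub>R blinfun_adjoint A" for c and A :: "'a \<Rightarrow>\<^sub>L 'b"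
    proof (rule blinfun_eqI, rule vector_eq_ldot[THEN iffD1, rule_format])
      show "x \<bullet> blinfun_adjoint (c *\<^sub>R A) u = x \<bullet> (c *\<^sub>R blinfun_adjoint A) u" for x u
        by (simp add: inner_blinfun_adjoint[symmetric] blinfun.scaleR_left)
    qed
    show "norm (blinfun_adjoint A) \<le> norm A * 1" for A :: "'a \<Rightarrow>\<^sub>L 'b"
      by (simp add: norm_blinfun_adjoint_le)
  qed
  from bounded_linear.continuous_on[OF this assms] show ?thesis .
qed

text \<open>\<open>coercive_inv_diff\<close> with base point \<open>a\<close> gives a majorant that
  tends to \<open>0\<close> at \<open>a\<close>. The coercivity constant varies with
  \<open>t\<close> because \<epsilon> decays to \<open>0\<close>.\<close>

lemma continuous_on_inv_coercive:
  fixes B :: "real \<Rightarrow> 'a::{real_inner,banach} \<Rightarrow>\<^sub>L 'a"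
  assumes B: "continuous_on S B" and b: "continuous_on S b" and e: "continuous_on S e"
    and e_pos: "\<And>t. t \<in> S \<Longrightarrow> e t > 0"
    and coercive: "\<And>t x. t \<in> S \<Longrightarrow> e t * (norm x)\<^sup>2 \<le> B t x \<bullet> x"
  shows "continuous_on S (\<lambda>t. inv (B t) (b t))"
  unfolding continuous_on_def
proof
  fix a assume a: "a \<in> S"
  let ?F = "at a within S" and ?c = "inv (B a) (b a)"
  have lim: "((\<lambda>t. (norm (b t - b a) + norm (B t - B a) * norm ?c) / e t) \<longlongrightarrow>
      (norm (b a - b a) + norm (B a - B a) * norm ?c) / e a) ?F"
    using a B b e e_pos unfolding continuous_on_def
    by (intro tendsto_divide tendsto_add tendsto_mult tendsto_norm tendsto_diff tendsto_const) force+
  have lim: "((\<lambda>t. (norm (b t - b a) + norm (B t - B a) * norm ?c) / e t) \<longlongrightarrow> 0) ?F"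
    using lim by simp
  have "\<forall>\<^sub>F t in ?F. norm (inv (B t) (b t) - ?c) \<le> (norm (b t - b a) + norm (B t - B a) * norm ?c) / e t"
    unfolding eventually_at_filter
    by (rule always_eventually) (use coercive_inv_diff e_pos coercive a in blast)
  from Lim_null_comparison[OF this lim]
  show "((\<lambda>t. inv (B t) (b t)) \<longlongrightarrow> ?c) ?F" by (rule LIM_zero_cancel)
qed

lemma positive_Top: "positive_blinfun (Top F' h)"
  unfolding positive_blinfun_def by (simp add: inner_Top) (metis inner_Top inner_commute)

text \<open>The cases \<open>g = 1\<close> and \<open>g = [:0, 1:]\<close> of
  \<open>resolvent_powr_bound\<close>; the form of the second at \<open>T(y)\<close> is
  \<open>(norm (F' y x))\<^sup>2\<close>. The two bounds become the two terms of
  \<open>gam\<close>.\<close>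

lemma source_resolvent_bounds:
  assumes N1: "N1 > 0" "norm (F' y) \<le> N1" and s: "1/2 \<le> s" "s \<le> 1" and e: "e > 0"
    and x: "Treg F' e y x = blinfun_powr (Top F' y) s v"
  shows "norm x \<le> e powr (s - 1) * zeta_const s * norm v"
    and "norm (F' y x) \<le> N1 powr (2 * (s + 1/2)) / (N1\<^sup>2 + e) * norm v"
proof -
  have s0: "s > 0" using s by simp
  have x': "Top F' y x + e *\<^sub>R x = blinfun_powr (Top F' y) s v"
    using x by (simp add: Treg_def blinfun.add_left blinfun.scaleR_left)
  have A: "positive_blinfun (Top F' y)" by (rule positive_Top)
  have nA: "norm (Top F' y) \<le> N1\<^sup>2" using N1 by (intro norm_Top_le)
  have zc: "zeta_const s \<ge> 0" by (simp add: zeta_const_def)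
  have "poly_blinfun 1 (Top F' y) x \<bullet> x \<le> (e powr (s - 1) * zeta_const s * norm v)\<^sup>2"
  proof (rule resolvent_powr_bound[OF A s0 e x'])
    fix l assume l: "0 \<le> l" "l \<le> norm (Top F' y)"
    have "(l powr s)\<^sup>2 \<le> (e powr (s - 1) * zeta_const s * (l + e))\<^sup>2"
      using zeta_const_bound[OF s0 s(2) e l(1)] by (intro power_mono) auto
    then show "poly 1 l * (l powr s)\<^sup>2 \<le> (e powr (s - 1) * zeta_const s * (l + e))\<^sup>2" by simp
  qed
  then have "(norm x)\<^sup>2 \<le> (e powr (s - 1) * zeta_const s * norm v)\<^sup>2"
    by (simp add: one_pCons poly_blinfun_apply_pCons power2_norm_eq_inner)
  then show "norm x \<le> e powr (s - 1) * zeta_const s * norm v"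
    by (rule power2_le_imp_le) (use zc in simp)
  have "poly_blinfun [:0, 1:] (Top F' y) x \<bullet> x \<le> (N1 powr (2 * (s + 1/2)) / (N1\<^sup>2 + e) * norm v)\<^sup>2"
  proof (rule resolvent_powr_bound[OF A s0 e x'])
    fix l assume l: "0 \<le> l" "l \<le> norm (Top F' y)"
    then show "poly [:0, 1:] l * (l powr s)\<^sup>2 \<le> (N1 powr (2 * (s + 1/2)) / (N1\<^sup>2 + e) * (l + e))\<^sup>2"
      using sqrt_powr_bound[OF N1(1) s(1) e l(1)] nA by simp
  qed
  then have "(norm (F' y x))\<^sup>2 \<le> (N1 powr (2 * (s + 1/2)) / (N1\<^sup>2 + e) * norm v)\<^sup>2"
    by (simp add: poly_blinfun_apply_pCons power2_norm_eq_inner inner_Top)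
  then show "norm (F' y x) \<le> N1 powr (2 * (s + 1/2)) / (N1\<^sup>2 + e) * norm v"
    by (rule power2_le_imp_le) (use e in simp)
qed

section \<open>The regularized Newton flow\<close>

text \<open>Up to errors the flow is \<open>-(h - y)\<close>. The three errors are the Taylor
  remainder, the bias \<open>\<epsilon> T_\<epsilon>(y)^-1 (y - z0)\<close> of the regularization,
  and the price of moving the inverse from \<open>h\<close> to \<open>y\<close>.\<close>

lemma norm_Phi_add_le:
  fixes F :: "'a::{real_inner,banach} \<Rightarrow> 'a"
  assumes sol: "F y = 0"
    and F': "\<And>x. (F has_derivative blinfun_apply (F' x)) (at x)"
    and lip: "\<And>x y. norm (F' x - F' y) \<le> N2 * norm (x - y)"
    and N1: "N1 > 0" "norm (F' y) \<le> N1" and s: "1/2 \<le> s" "s \<le> 1" and e: "\<epsilon> t > 0"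
    and source: "y - z0 = blinfun_powr (Top F' y) s v"
  shows "norm (Phi F F' z0 \<epsilon> h t + (h - y)) \<le> N2 / (4 * sqrt (\<epsilon> t)) * (norm (h - y))\<^sup>2
    + \<epsilon> t powr s * zeta_const s * norm v + (1 - gam N1 N2 s v \<epsilon> t) * norm (h - y)"
proof -
  define e where "e = \<epsilon> t"
  have e: "e > 0" using e by (simp add: e_def)
  define w where "w = h - y"
  define r where "r = F' h w - F h"
  define iB where "iB = inv (Treg F' e h)"
  define p where "p = iB (blinfun_adjoint (F' h) r)"
  define x where "x = inv (Treg F' e y) (y - z0)"
  define q where "q = iB (y - z0)"
  define X where "X = e powr (s - 1) * zeta_const s * norm v"
  define K where "K = N1 powr (2 * (s + 1/2)) / (N1\<^sup>2 + e) * norm v"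
  have Tx: "Treg F' e y x = y - z0" using e by (simp add: x_def Treg_inv)
  have x: "norm x \<le> X" "norm (F' y x) \<le> K"
    using source_resolvent_bounds[where F' = F' and y = y, OF N1 s e] Tx source unfolding X_def K_def by auto
  have "norm (F y - F h - F' h (y - h)) \<le> N2 / 2 * (norm (y - h))\<^sup>2"
    by (rule taylor_remainder_bound[OF F' lip])
  moreover have "F y - F h - F' h (y - h) = r"
    by (simp add: sol r_def w_def blinfun.diff_right)
  ultimately have r: "norm r \<le> N2 / 2 * (norm w)\<^sup>2"
    by (simp add: w_def norm_minus_commute)
  have "blinfun_adjoint (F' h) (F h) + e *\<^sub>R (h - z0)
      = Treg F' e h w - blinfun_adjoint (F' h) r + e *\<^sub>R (y - z0)"
    by (simp add: Treg_apply r_def w_def blinfun.diff_right blinfun.add_right algebra_simps)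
  moreover have "iB (Treg F' e h w) = w" unfolding iB_def by (rule inv_Treg_eqI[OF e refl])
  ultimately have Phi: "Phi F F' z0 \<epsilon> h t + w = p - e *\<^sub>R q"
    using e by (simp add: Phi_def e_def[symmetric] iB_def[symmetric] p_def q_def)
      (simp add: iB_def inv_Treg_add inv_Treg_diff inv_Treg_scaleR)
  have p: "norm p \<le> N2 / (4 * sqrt e) * (norm w)\<^sup>2"
  proof -
    have "norm p \<le> norm r / (2 * sqrt e)"
      unfolding p_def iB_def by (rule norm_inv_Treg_adjoint_le[OF e])
    also have "\<dots> \<le> (N2 / 2 * (norm w)\<^sup>2) / (2 * sqrt e)"
      using r e by (intro divide_right_mono) auto
    finally show ?thesis by simp
  qed
  have diff: "norm (F' y - F' h) \<le> N2 * norm w"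
    using lip[of y h] by (simp add: w_def norm_minus_commute)
  have qx: "norm (q - x) \<le> (N2 * norm w * X) / (2 * sqrt e) + (N2 * norm w * K) / e"
  proof -
    \<comment> \<open>\<open>T(y) - T(h)\<close> at \<open>x\<close> is split so that the adjoint of
      \<open>F' h\<close> faces the inverse at \<open>a\<close>, for the factor
      \<open>1/(2 sqrt e)\<close>, and \<open>F' y\<close> faces \<open>x\<close> in
      \<open>b\<close>, for the bound \<open>K\<close>.\<close>
    define a b where "a = (F' y - F' h) x" and "b = blinfun_adjoint (F' y - F' h) (F' y x)"
    have "Treg F' e h x + blinfun_adjoint (F' h) a + b = y - z0"
      unfolding Tx[symmetric] a_def b_def
      by (simp add: Treg_apply blinfun.bilinear_simps blinfun_adjoint_diff)
    then have "q = x + iB (blinfun_adjoint (F' h) a) + iB b"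
      unfolding q_def iB_def using e
      by (intro inv_Treg_eqI) (simp_all add: blinfun.add_right Treg_inv)
    then have "norm (q - x) \<le> norm (iB (blinfun_adjoint (F' h) a)) + norm (iB b)"
      by (simp add: norm_triangle_ineq add.assoc)
    also have "\<dots> \<le> norm a / (2 * sqrt e) + norm b / e"
      unfolding iB_def by (intro add_mono norm_inv_Treg_adjoint_le norm_inv_Treg_le e)
    also have "\<dots> \<le> (N2 * norm w * X) / (2 * sqrt e) + (N2 * norm w * K) / e"
    proof (intro add_mono divide_right_mono)
      have "norm a \<le> norm (F' y - F' h) * norm x" unfolding a_def by (rule norm_blinfun)
      also have "\<dots> \<le> N2 * norm w * X"
        using diff x(1) order_trans[OF norm_ge_zero diff] by (intro mult_mono) auto
      finally show "norm a \<le> N2 * norm w * X" .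
      have "norm b \<le> norm (blinfun_adjoint (F' y - F' h)) * norm (F' y x)"
        unfolding b_def by (rule norm_blinfun)
      also have "\<dots> \<le> N2 * norm w * K"
        using order_trans[OF norm_blinfun_adjoint_le diff] x(2) order_trans[OF norm_ge_zero diff]
        by (intro mult_mono) auto
      finally show "norm b \<le> N2 * norm w * K" .
    qed (use e in auto)
    finally show ?thesis .
  qed
  have eX: "e * X = e powr s * zeta_const s * norm v"
    using e by (simp add: X_def powr_diff)
  have "norm (e *\<^sub>R q) \<le> e * (norm x + norm (q - x))"
    using e norm_triangle_sub[of q x] by simp
  also have "\<dots> \<le> e * (X + ((N2 * norm w * X) / (2 * sqrt e) + (N2 * norm w * K) / e))"
    using x(1) qx e by (intro mult_left_mono add_mono) auto
  also have "\<dots> = e * X + (N2 * (e * X) / (2 * sqrt e) + N2 * K) * norm w"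
    using e by (simp add: field_simps)
  also have "N2 * (e * X) / (2 * sqrt e) + N2 * K = 1 - gam N1 N2 s v \<epsilon> t"
  proof -
    have "e powr (s - 1/2) = e powr s / sqrt e"
      using e by (simp add: powr_diff powr_half_sqrt)
    then show ?thesis unfolding eX by (simp add: gam_def K_def e_def ac_simps)
  qed
  finally have "norm (e *\<^sub>R q) \<le> e * X + (1 - gam N1 N2 s v \<epsilon> t) * norm w" .
  then have "norm (p - e *\<^sub>R q) \<le> N2 / (4 * sqrt e) * (norm w)\<^sup>2
      + (e * X + (1 - gam N1 N2 s v \<epsilon> t) * norm w)"
    using p by (intro order_trans[OF norm_triangle_ineq4] add_mono)
  then show ?thesis unfolding Phi[symmetric] eX by (simp add: w_def e_def)
qed

text \<open>The left-hand side of the conclusion is the derivative of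
  \<open>(norm (h - y))\<^sup>2 / 2\<close> along the flow.\<close>

lemma inner_Phi_le:
  fixes F :: "'a::{real_inner,banach} \<Rightarrow> 'a"
  assumes "norm (Phi F F' z0 \<epsilon> h t + (h - y)) \<le> a + (1 - g) * norm (h - y)"
  shows "(h - y) \<bullet> Phi F F' z0 \<epsilon> h t \<le> norm (h - y) * (a - g * norm (h - y))"
proof -
  let ?w = "h - y" and ?P = "Phi F F' z0 \<epsilon> h t"
  have "?w \<bullet> (?P + ?w) \<le> norm ?w * norm (?P + ?w)" by (rule norm_cauchy_schwarz)
  also have "\<dots> \<le> norm ?w * (a + (1 - g) * norm ?w)"
    using assms by (intro mult_left_mono) auto
  finally show ?thesis
    unfolding inner_add_right power2_norm_eq_inner[symmetric]
    by (simp add: power2_eq_square algebra_simps)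
qed

lemma norm_Phi_le:
  assumes "\<epsilon> t > 0"
  shows "norm (Phi F F' z0 \<epsilon> h t)
    \<le> norm (blinfun_adjoint (F' h) (F h) + \<epsilon> t *\<^sub>R (h - z0)) / \<epsilon> t"
  unfolding Phi_def norm_minus_cancel by (rule norm_inv_Treg_le[OF assms])

text \<open>On the ball of radius \<open>R\<close> about a zero of \<open>F\<close>; \<open>D\<close> bounds the distance of \<open>z0\<close> to that zero.\<close>

definition Phi_bound :: "real \<Rightarrow> real \<Rightarrow> real \<Rightarrow> real \<Rightarrow> real" where
  "Phi_bound N1 R D e = (N1\<^sup>2 * R + e * (R + D)) / e"

definition Phi_lipschitz :: "real \<Rightarrow> real \<Rightarrow> real \<Rightarrow> real \<Rightarrow> real \<Rightarrow> real" where
  "Phi_lipschitz N1 N2 R D e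
    = (N1 * N2 * R + N1\<^sup>2 + e + 2 * N1 * N2 * Phi_bound N1 R D e) / e"

text \<open>Both bounds depend on \<open>t\<close> through \<open>\<epsilon> t\<close> alone, hence
  continuously. They may blow up as \<epsilon> tends to \<open>0\<close>, which the time-dependent
  \<open>L\<close> of the Cauchy problem lemmas allows.\<close>

lemma Phi_ball:
  fixes F :: "'a::{real_inner,banach} \<Rightarrow> 'a"
  assumes sol: "F y = 0"
    and F_lip: "\<And>x y. norm (F x - F y) \<le> N1 * norm (x - y)"
    and lip: "\<And>x y. norm (F' x - F' y) \<le> N2 * norm (x - y)"
    and N1: "\<And>x. norm (F' x) \<le> N1" and e: "\<epsilon> t > 0"
    and h: "norm (h - y) \<le> R" and D: "norm (y - z0) \<le> D"
  shows "norm (Phi F F' z0 \<epsilon> h t) \<le> Phi_bound N1 R D (\<epsilon> t)"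
    and "norm (k - y) \<le> R \<Longrightarrow> norm (Phi F F' z0 \<epsilon> k t - Phi F F' z0 \<epsilon> h t)
      \<le> Phi_lipschitz N1 N2 R D (\<epsilon> t) * norm (k - h)"
proof -
  have N1_nonneg: "N1 \<ge> 0" using order_trans[OF norm_ge_zero N1] .
  have R_nonneg: "R \<ge> 0" using order_trans[OF norm_ge_zero h] .
  have adj: "norm (blinfun_adjoint A u) \<le> M * U" if "norm A \<le> M" "norm u \<le> U" for A :: "'a \<Rightarrow>\<^sub>L 'a" and u M U
  proof -
    have "norm (blinfun_adjoint A u) \<le> norm (blinfun_adjoint A) * norm u" by (rule norm_blinfun)
    also have "\<dots> \<le> M * U"
      using that order_trans[OF norm_blinfun_adjoint_le that(1)] order_trans[OF norm_ge_zero that(1)]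
      by (intro mult_mono) auto
    finally show ?thesis .
  qed
  have F_le: "norm (F h) \<le> N1 * R" if "norm (h - y) \<le> R" for h
  proof -
    have "norm (F h) \<le> N1 * norm (h - y)" using F_lip[of h y] sol by simp
    also have "\<dots> \<le> N1 * R" using that N1_nonneg by (rule mult_left_mono)
    finally show ?thesis .
  qed
  define b where "b h = blinfun_adjoint (F' h) (F h) + \<epsilon> t *\<^sub>R (h - z0)" for h
  have b_le: "norm (b h) \<le> N1\<^sup>2 * R + \<epsilon> t * (R + D)"
  proof -
    have "norm (b h) \<le> norm (blinfun_adjoint (F' h) (F h)) + norm (\<epsilon> t *\<^sub>R (h - z0))"
      unfolding b_def by (rule norm_triangle_ineq)
    also have "norm (blinfun_adjoint (F' h) (F h)) \<le> N1 * (N1 * R)"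
      by (rule adj[OF N1 F_le[OF h]])
    also have "norm (h - z0) \<le> R + D"
      using norm_triangle_ineq[of "h - y" "y - z0"] h D by simp
    then have "norm (\<epsilon> t *\<^sub>R (h - z0)) \<le> \<epsilon> t * (R + D)" using e by simp
    finally show ?thesis by (simp add: power2_eq_square)
  qed
  show Phi_h: "norm (Phi F F' z0 \<epsilon> h t) \<le> Phi_bound N1 R D (\<epsilon> t)"
    using norm_Phi_le[of \<epsilon> t F F' z0 h, OF e] b_le e unfolding Phi_bound_def b_def[symmetric]
    by (meson divide_right_mono less_imp_le order_trans)
  assume k: "norm (k - y) \<le> R"
  have b_diff: "norm (b k - b h) \<le> (N1 * N2 * R + N1\<^sup>2 + \<epsilon> t) * norm (k - h)"
  proof -
    have "b k - b h = blinfun_adjoint (F' k - F' h) (F k) + blinfun_adjoint (F' h) (F k - F h)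
        + \<epsilon> t *\<^sub>R (k - h)"
      by (simp add: b_def blinfun_adjoint_diff blinfun.bilinear_simps algebra_simps)
    also have "norm \<dots> \<le> norm (blinfun_adjoint (F' k - F' h) (F k))
        + norm (blinfun_adjoint (F' h) (F k - F h)) + norm (\<epsilon> t *\<^sub>R (k - h))"
      by (intro order_trans[OF norm_triangle_ineq] add_right_mono norm_triangle_ineq)
    also have "\<dots> \<le> N2 * norm (k - h) * (N1 * R) + N1 * (N1 * norm (k - h)) + \<epsilon> t * norm (k - h)"
      using e by (intro add_mono adj lip N1 F_lip F_le k) auto
    finally show ?thesis by (simp add: power2_eq_square algebra_simps)
  qed
  have T_diff: "norm (Treg F' (\<epsilon> t) k - Treg F' (\<epsilon> t) h) \<le> 2 * N1 * N2 * norm (k - h)"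
  proof -
    have "norm (Treg F' (\<epsilon> t) k - Treg F' (\<epsilon> t) h) \<le> 2 * N1 * norm (F' k - F' h)"
      using norm_Top_diff_le[of F', OF N1] by (simp add: Treg_def)
    also have "\<dots> \<le> 2 * N1 * (N2 * norm (k - h))"
      using N1_nonneg by (intro mult_left_mono lip) auto
    finally show ?thesis by (simp add: mult.assoc)
  qed
  have "norm (Phi F F' z0 \<epsilon> k t - Phi F F' z0 \<epsilon> h t)
      = norm (inv (Treg F' (\<epsilon> t) k) (b k) - inv (Treg F' (\<epsilon> t) h) (b h))"
    by (simp add: Phi_def b_def norm_minus_commute)
  also have "\<dots> \<le> (norm (b k - b h) + norm (Treg F' (\<epsilon> t) k - Treg F' (\<epsilon> t) h)
      * norm (inv (Treg F' (\<epsilon> t) h) (b h))) / \<epsilon> t"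
    by (rule coercive_inv_diff[OF e Treg_coercive e Treg_coercive])
  also have "norm (inv (Treg F' (\<epsilon> t) h) (b h)) = norm (Phi F F' z0 \<epsilon> h t)"
    by (simp add: Phi_def b_def)
  also have "(norm (b k - b h) + norm (Treg F' (\<epsilon> t) k - Treg F' (\<epsilon> t) h) * norm (Phi F F' z0 \<epsilon> h t)) / \<epsilon> t
      \<le> ((N1 * N2 * R + N1\<^sup>2 + \<epsilon> t) * norm (k - h)
        + 2 * N1 * N2 * norm (k - h) * Phi_bound N1 R D (\<epsilon> t)) / \<epsilon> t"
    using e order_trans[OF norm_ge_zero T_diff]
    by (intro divide_right_mono add_mono b_diff mult_mono T_diff Phi_h) auto
  also have "\<dots> = Phi_lipschitz N1 N2 R D (\<epsilon> t) * norm (k - h)"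
    by (simp add: Phi_lipschitz_def algebra_simps add_divide_distrib)
  finally show "norm (Phi F F' z0 \<epsilon> k t - Phi F F' z0 \<epsilon> h t)
      \<le> Phi_lipschitz N1 N2 R D (\<epsilon> t) * norm (k - h)" .
qed

lemma continuous_on_Phi:
  assumes F: "continuous_on UNIV F" and F': "continuous_on UNIV F'"
    and z: "continuous_on S z" and e: "continuous_on S \<epsilon>" "\<And>t. t \<in> S \<Longrightarrow> \<epsilon> t > 0"
  shows "continuous_on S (\<lambda>t. Phi F F' z0 \<epsilon> (z t) t)"
proof -
  have Fz: "continuous_on S (\<lambda>t. F (z t))" "continuous_on S (\<lambda>t. F' (z t))"
    using continuous_on_compose2[OF F z] continuous_on_compose2[OF F' z] by auto
  have "continuous_on S (\<lambda>t. inv (Treg F' (\<epsilon> t) (z t))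
      (blinfun_adjoint (F' (z t)) (F (z t)) + \<epsilon> t *\<^sub>R (z t - z0)))"
  proof (rule continuous_on_inv_coercive[where e = \<epsilon>])
    show "continuous_on S (\<lambda>t. Treg F' (\<epsilon> t) (z t))"
      unfolding Treg_def Top_def
      by (intro continuous_intros Fz e bounded_bilinear.continuous_on[OF bounded_bilinear_blinfun_compose])
  qed (auto intro!: continuous_intros Fz e z Treg_coercive)
  then show ?thesis unfolding Phi_def by (rule continuous_on_minus)
qed

text \<open>In an inner product space this is the metric projection onto the ball;
  \<open>max\<close> merges the two cases and keeps the denominator positive for
  \<open>R > 0\<close>.\<close>

definition radial_retract :: "real \<Rightarrow> 'a::real_normed_vector \<Rightarrow> 'a" where
  "radial_retract R w = (R / max R (norm w)) *\<^sub>R w"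

lemma radial_retract_id: "R > 0 \<Longrightarrow> norm w \<le> R \<Longrightarrow> radial_retract R w = w"
  by (simp add: radial_retract_def max_def)

lemma norm_radial_retract_le:
  assumes "R > 0"
  shows "norm (radial_retract R w) \<le> R"
proof -
  have "norm (radial_retract R w) = R * norm w / max R (norm w)"
    using assms by (simp add: radial_retract_def)
  also have "\<dots> \<le> R" using assms by (simp add: pos_divide_le_eq mult_left_mono)
  finally show ?thesis .
qed

text \<open>One unit of the constant comes from moving the vector, the other from changing its
  scaling factor.\<close>

lemma radial_retract_lipschitz:
  assumes R: "R > 0"
  shows "norm (radial_retract R a - radial_retract R b) \<le> 2 * norm (a - b)"
proof -
  define A B where "A = max R (norm a)" and "B = max R (norm b)"
  have AB: "A > 0" "B > 0" "R \<le> A" "norm b \<le> B" using R by (auto simp: A_def B_def)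
  have diff: "\<bar>B - A\<bar> \<le> norm (a - b)"
    using norm_triangle_ineq3[of a b] by (auto simp: A_def B_def max_def)
  have "radial_retract R a - radial_retract R b = (R / A) *\<^sub>R (a - b) + (R / A - R / B) *\<^sub>R b"
    by (simp add: radial_retract_def A_def B_def algebra_simps)
  then have "norm (radial_retract R a - radial_retract R b)
      \<le> R / A * norm (a - b) + \<bar>R / A - R / B\<bar> * norm b"
    using R AB norm_triangle_ineq[of "(R / A) *\<^sub>R (a - b)" "(R / A - R / B) *\<^sub>R b"] by simp
  also have "\<dots> \<le> 1 * norm (a - b) + norm (a - b)"
  proof (intro add_mono mult_right_mono)
    have "\<bar>R / A - R / B\<bar> * norm b = (R / A) * \<bar>B - A\<bar> * (norm b / B)"
    proof -
      have "R / A - R / B = (R / A) * ((B - A) / B)" using AB by (simp add: field_simps)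
      then show ?thesis using R AB by (simp add: abs_mult)
    qed
    also have "\<dots> \<le> 1 * norm (a - b) * 1"
      using AB R diff by (intro mult_mono) auto
    finally show "\<bar>R / A - R / B\<bar> * norm b \<le> norm (a - b)" by simp
  qed (use AB in auto)
  finally show ?thesis by simp
qed

theorem theorem4p9:
  fixes F :: "'a::{real_inner,banach} \<Rightarrow> 'a"
    and F' :: "'a \<Rightarrow> 'a \<Rightarrow>\<^sub>L 'a"
    and F'' :: "'a \<Rightarrow> 'a \<Rightarrow>\<^sub>L ('a \<Rightarrow>\<^sub>L 'a)"
    and z0 y v :: 'a
    and N1 N2 \<zeta> C0 :: real
    and \<epsilon> \<epsilon>' :: "real \<Rightarrow> real"
  assumes sol: "F y = 0" and sol_unique: "\<And>x. F x = 0 \<Longrightarrow> x = y"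
    and F': "\<And>x. (F has_derivative blinfun_apply (F' x)) (at x)"
    and F'': "\<And>x. (F' has_derivative blinfun_apply (F'' x)) (at x)"
    and N1_pos: "N1 > 0" and N2_pos: "N2 > 0"
    and F'_bound: "\<And>x. norm (F' x) \<le> N1"
    and F''_bound: "\<And>x. norm (F'' x) \<le> N2"
    and zeta: "1/2 \<le> \<zeta>" "\<zeta> \<le> 1"
    and source: "y - z0 = blinfun_powr (Top F' y) \<zeta> v"
    and eps_pos: "\<And>t. t \<ge> 0 \<Longrightarrow> \<epsilon> t > 0"
    and smallness: "\<And>t. t \<ge> 0 \<Longrightarrow>
      (1/2 * \<epsilon> t powr (\<zeta> - 1/2) * N2 * zeta_const \<zeta>
        + N1 powr (2 * (\<zeta> + 1/2)) * N2 / (N1\<^sup>2 + \<epsilon> t)) * norm v < 1"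
    and eps_deriv: "\<And>t. t \<ge> 0 \<Longrightarrow> (\<epsilon> has_real_derivative \<epsilon>' t) (at t within {0..})"
    and eps'_cont: "continuous_on {0..} \<epsilon>'"
    and eps_mono: "antimono_on {0..} \<epsilon>"
    and eps_lim: "(\<epsilon> \<longlongrightarrow> 0) at_top"
    and C0_attained: "\<exists>t\<ge>0. C0 = gam N1 N2 \<zeta> v \<epsilon> t - \<zeta> * \<bar>\<epsilon>' t\<bar> / \<epsilon> t"
    and C0_least: "\<And>t. t \<ge> 0 \<Longrightarrow> C0 \<le> gam N1 N2 \<zeta> v \<epsilon> t - \<zeta> * \<bar>\<epsilon>' t\<bar> / \<epsilon> t"
    and C0_pos: "C0 > 0"
    (* quotients in ereal: a quotient whose denominator norm v or norm (y - z0)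
       vanishes is infinite, not 0 *)
    and initial: "ereal (N2 * \<epsilon> 0 powr (\<zeta> - 1/2) / (2 * C0))
      < min (ereal C0 / ereal (2 * zeta_const \<zeta> * norm v))
            (ereal (\<epsilon> 0 powr \<zeta>) / ereal (norm (y - z0)))"
  shows "\<exists>z. solves_cauchy (Phi F F' z0 \<epsilon>) z0 z
    \<and> (\<forall>w. solves_cauchy (Phi F F' z0 \<epsilon>) z0 w \<longrightarrow> (\<forall>t\<ge>0. w t = z t))
    \<and> (\<forall>t\<ge>0. norm (z t - y) \<le> 2 * C0 / (N2 * \<epsilon> 0 powr (\<zeta> - 1/2)) * \<epsilon> t powr \<zeta>)"
proof -
  define D where "D = norm (y - z0)"
  define \<kappa> where "\<kappa> = N2 * \<epsilon> 0 powr (\<zeta> - 1/2)"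
  \<comment> \<open>Vertex of the parabola \<open>\<kappa> u\<^sup>2 / 4 - C0 u + c\<close>, whose
    minimum is \<open>c - C0\<^sup>2 / \<kappa>\<close>.\<close>
  define U where "U = 2 * C0 / \<kappa>"
  define \<rho> where "\<rho> t = U * \<epsilon> t powr \<zeta>" for t
  define R where "R = \<rho> 0"
  define c where "c = zeta_const \<zeta> * norm v"
  note e0 = eps_pos[of 0, simplified]
  have \<kappa>: "\<kappa> > 0" using N2_pos e0 by (simp add: \<kappa>_def)
  have U: "U > 0" using C0_pos \<kappa> by (simp add: U_def)
  have \<rho>_pos: "\<rho> t > 0" if "t \<ge> 0" for t using U eps_pos[OF that] by (simp add: \<rho>_def)
  have R: "R > 0" using \<rho>_pos[of 0] by (simp add: R_def)
  have eps_le: "\<epsilon> t \<le> \<epsilon> 0" if "t \<ge> 0" for t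
    using eps_mono that by (auto simp: monotone_on_def)
  have \<rho>_le: "\<rho> t \<le> R" if "t \<ge> 0" for t
    unfolding R_def \<rho>_def using eps_le[OF that] eps_pos[OF that] U zeta
    by (intro mult_left_mono powr_mono2) auto
  have zc: "zeta_const \<zeta> > 0" using zeta by (auto simp: zeta_const_def)
  \<comment> \<open>The minimum of that parabola is negative. For \<open>v = 0\<close> the quotient
    in \<open>initial\<close> is infinite, but then \<open>c = 0\<close>.\<close>
  have small: "\<kappa> * c < C0\<^sup>2"
  proof (cases "v = 0")
    case False
    then have "\<kappa> / (2 * C0) < C0 / (2 * zeta_const \<zeta> * norm v)"
      using initial zc by (simp add: \<kappa>_def)
    then show ?thesis using False zc C0_pos by (simp add: c_def field_simps power2_eq_square)
  qed (use C0_pos in \<open>simp add: c_def\<close>)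
  \<comment> \<open>The second half of \<open>initial\<close>: the flow starts strictly inside the
    barrier.\<close>
  have D_less: "D < R"
  proof (cases "y = z0")
    case False
    then have "\<kappa> / (2 * C0) < \<epsilon> 0 powr \<zeta> / D"
      using initial by (simp add: \<kappa>_def D_def)
    then show ?thesis using False C0_pos \<kappa> by (simp add: D_def R_def \<rho>_def U_def field_simps)
  qed (use R in \<open>simp add: D_def\<close>)
  have F_lip: "norm (F a - F b) \<le> N1 * norm (a - b)" for a b
    by (rule lipschitz_of_derivative_bound[OF F' F'_bound])
  have F'_lip: "norm (F' a - F' b) \<le> N2 * norm (a - b)" for a b
    by (rule lipschitz_of_derivative_bound[OF F'' F''_bound])
  have F_cont: "continuous_on UNIV F" "continuous_on UNIV F'"
    using has_derivative_continuous[OF F'] has_derivative_continuous[OF F''] by (auto simp: continuous_on_eq_continuous_within)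
  have eps_cont: "continuous_on {0..} \<epsilon>"
    by (rule DERIV_continuous_on) (use eps_deriv in auto)

  \<comment> \<open>Stated for any field \<open>g\<close> that agrees with \<open>Phi\<close> on the
    ball, since it is applied both to the cut-off field and to \<open>Phi\<close> itself. At contact
    the solution is at distance \<open>\<rho> t \<le> R\<close>, so the barrier sees only this
    agreement.\<close>
  have stays: "norm (z t - y) < \<rho> t"
    if z: "solves_cauchy g z0 z" and g: "\<And>h t. norm (h - y) \<le> R \<Longrightarrow> g h t = Phi F F' z0 \<epsilon> h t"
      and t: "t \<ge> 0" for g z t
  proof -
    \<comment> \<open>Squares are compared because the norm is not differentiable at
      \<open>0\<close>.\<close>
    have "(norm (z t - y))\<^sup>2 - (\<rho> t)\<^sup>2 < 0"
    proof (rule barrier[OF _ _ _ t])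
      fix t :: real assume t: "t \<ge> 0"
      have e: "\<epsilon> t > 0" by (rule eps_pos[OF t])
      have "((\<lambda>t. z t - y) has_vector_derivative g (z t) t) (at t within {0..})"
        using has_vector_derivative_diff[OF solves_cauchyD(2)[OF z t] has_vector_derivative_const[of y]]
        by simp
      note z_deriv = has_real_derivative_norm_power2[OF this]
      have "(\<rho> has_real_derivative U * (\<zeta> * \<epsilon> t powr (\<zeta> - 1) * \<epsilon>' t)) (at t within {0..})"
        unfolding \<rho>_def
        by (intro DERIV_cmult DERIV_chain'[OF eps_deriv[OF t] has_real_derivative_powr[OF e]])
      then have "((\<lambda>t. (\<rho> t)\<^sup>2) has_real_derivative 2 * \<rho> t * (U * (\<zeta> * \<epsilon> t powr (\<zeta> - 1) * \<epsilon>' t)))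
          (at t within {0..})"
        by (auto intro!: derivative_eq_intros)
      from DERIV_diff[OF z_deriv this]
      show "((\<lambda>t. (norm (z t - y))\<^sup>2 - (\<rho> t)\<^sup>2) has_real_derivative
          2 * ((z t - y) \<bullet> g (z t) t) - 2 * \<rho> t * (U * (\<zeta> * \<epsilon> t powr (\<zeta> - 1) * \<epsilon>' t)))
          (at t within {0..})" .
      assume "(norm (z t - y))\<^sup>2 - (\<rho> t)\<^sup>2 = 0"
      then have n: "norm (z t - y) = \<rho> t" using \<rho>_pos[OF t] by (simp add: power2_eq_iff_nonneg)
      define \<gamma> where "\<gamma> = gam N1 N2 \<zeta> v \<epsilon> t"
      define a where "a = N2 / (4 * sqrt (\<epsilon> t)) * (\<rho> t)\<^sup>2 + \<epsilon> t powr \<zeta> * c"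
      have "(z t - y) \<bullet> g (z t) t \<le> \<rho> t * (a - \<gamma> * \<rho> t)"
        using inner_Phi_le[of F F' z0 \<epsilon> "z t" t y a \<gamma>]
          norm_Phi_add_le[where F = F and F' = F' and h = "z t" and y = y and \<epsilon> = \<epsilon> and t = t, OF sol F' F'_lip N1_pos F'_bound zeta e source]
          g[of "z t" t] \<rho>_le[OF t]
        by (simp add: n a_def \<gamma>_def c_def mult.assoc)
      \<comment> \<open>Divided by \<open>2 * \<rho> t\<close>, the derivative at contact is at most
        this; a further division by \<open>\<epsilon> t powr \<zeta>\<close> gives the Riccati
        right-hand side at \<open>U\<close>, still with coefficients depending on
        \<open>t\<close>.\<close>
      moreover have "a - \<gamma> * \<rho> t - U * (\<zeta> * \<epsilon> t powr (\<zeta> - 1) * \<epsilon>' t) < 0"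
      proof -
        have "\<epsilon> t powr (\<zeta> - 1/2) = \<epsilon> t powr \<zeta> / sqrt (\<epsilon> t)"
          using e by (simp add: powr_diff powr_half_sqrt)
        then have a: "a = \<epsilon> t powr \<zeta> * (N2 * \<epsilon> t powr (\<zeta> - 1/2) * U\<^sup>2 / 4 + c)"
          by (simp add: a_def \<rho>_def power2_eq_square algebra_simps)
        \<comment> \<open>Here \<open>\<zeta> \<ge> 1/2\<close> enters: the exponent is nonnegative,
          so the quadratic coefficient can be frozen at its initial value.\<close>
        have "\<epsilon> t powr (\<zeta> - 1/2) \<le> \<epsilon> 0 powr (\<zeta> - 1/2)"
          using eps_le[OF t] e zeta by (intro powr_mono2) auto
        then have "N2 * \<epsilon> t powr (\<zeta> - 1/2) * U\<^sup>2 / 4 \<le> \<kappa> * U\<^sup>2 / 4"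
          unfolding \<kappa>_def using N2_pos by (intro divide_right_mono mult_right_mono mult_left_mono) auto
        moreover have "\<kappa> * U\<^sup>2 / 4 = C0\<^sup>2 / \<kappa>"
          using \<kappa> by (simp add: U_def power2_eq_square)
        moreover have "c < C0\<^sup>2 / \<kappa>" using small \<kappa> by (simp add: pos_less_divide_eq mult.commute)
        moreover have "U * C0 \<le> U * (\<gamma> + \<zeta> * \<epsilon>' t / \<epsilon> t)"
        proof (rule mult_left_mono)
          have "- (\<zeta> * \<epsilon>' t / \<epsilon> t) \<le> \<zeta> * \<bar>\<epsilon>' t\<bar> / \<epsilon> t"
          proof -
            have "\<zeta> * (- \<epsilon>' t) / \<epsilon> t \<le> \<zeta> * \<bar>\<epsilon>' t\<bar> / \<epsilon> t"
              using zeta e by (intro divide_right_mono mult_left_mono) auto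
            then show ?thesis by simp
          qed
          then show "C0 \<le> \<gamma> + \<zeta> * \<epsilon>' t / \<epsilon> t" using C0_least[OF t] by (simp add: \<gamma>_def)
        qed (use U in simp)
        moreover have "U * C0 = 2 * (C0\<^sup>2 / \<kappa>)" by (simp add: U_def power2_eq_square)
        ultimately have "N2 * \<epsilon> t powr (\<zeta> - 1/2) * U\<^sup>2 / 4 + c - U * (\<gamma> + \<zeta> * \<epsilon>' t / \<epsilon> t) < 0"
          by linarith
        then have "\<epsilon> t powr \<zeta> * (N2 * \<epsilon> t powr (\<zeta> - 1/2) * U\<^sup>2 / 4 + c - U * (\<gamma> + \<zeta> * \<epsilon>' t / \<epsilon> t)) < 0"
          using e by (intro mult_pos_neg) auto
        also have "\<epsilon> t powr \<zeta> * (N2 * \<epsilon> t powr (\<zeta> - 1/2) * U\<^sup>2 / 4 + c - U * (\<gamma> + \<zeta> * \<epsilon>' t / \<epsilon> t))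
            = a - \<gamma> * \<rho> t - U * (\<zeta> * \<epsilon> t powr (\<zeta> - 1) * \<epsilon>' t)"
          unfolding a using e by (simp add: \<rho>_def powr_diff algebra_simps)
        finally show ?thesis .
      qed
      then have "2 * \<rho> t * (a - \<gamma> * \<rho> t - U * (\<zeta> * \<epsilon> t powr (\<zeta> - 1) * \<epsilon>' t)) < 0"
        using \<rho>_pos[OF t] by (intro mult_pos_neg) auto
      ultimately show "2 * ((z t - y) \<bullet> g (z t) t)
          - 2 * \<rho> t * (U * (\<zeta> * \<epsilon> t powr (\<zeta> - 1) * \<epsilon>' t)) < 0"
        using \<rho>_pos[OF t] by (simp add: right_diff_distrib mult.assoc)
    next
      have "(norm (z0 - y))\<^sup>2 < R\<^sup>2"
        using D_less by (intro power_strict_mono) (auto simp: D_def norm_minus_commute)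
      then show "(norm (z 0 - y))\<^sup>2 - (\<rho> 0)\<^sup>2 < 0" by (simp add: solves_cauchyD(1)[OF z] R_def)
    qed
    then have "(norm (z t - y))\<^sup>2 < (\<rho> t)\<^sup>2" by simp
    then show ?thesis by (rule power_less_imp_less_base) (use \<rho>_pos[OF t] in simp)
  qed

  define G where "G h t = Phi F F' z0 \<epsilon> (y + radial_retract R (h - y)) t" for h t
  have G: "G h t = Phi F F' z0 \<epsilon> h t" if "norm (h - y) \<le> R" for h t
    using R that by (simp add: G_def radial_retract_id)
  \<comment> \<open>The factor \<open>2\<close> is the Lipschitz constant of the retraction; the
    second summand covers the size of the field at \<open>z0\<close>, as
    \<open>solves_cauchy_exists\<close> requires.\<close>
  define L where "L t = 2 * Phi_lipschitz N1 N2 R D (\<epsilon> t) + Phi_bound N1 R D (\<epsilon> t)" for t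
  have L_cont: "continuous_on {0..} L"
    unfolding L_def Phi_lipschitz_def Phi_bound_def
    by (intro continuous_intros eps_cont) (use eps_pos in \<open>force+\<close>)
  have bound_nonneg: "0 \<le> Phi_bound N1 R D (\<epsilon> t)" "0 \<le> Phi_lipschitz N1 N2 R D (\<epsilon> t)" if "t \<ge> 0" for t
  proof -
    have D: "D \<ge> 0" by (simp add: D_def)
    show "0 \<le> Phi_bound N1 R D (\<epsilon> t)"
      unfolding Phi_bound_def using R D eps_pos[OF that] by simp
    then show "0 \<le> Phi_lipschitz N1 N2 R D (\<epsilon> t)"
      unfolding Phi_lipschitz_def using R N1_pos N2_pos eps_pos[OF that] by simp
  qed
  have retract: "norm (y + radial_retract R w - y) \<le> R" for w :: 'a
    using norm_radial_retract_le[OF R] by simp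
  note Phi_ball' = Phi_ball[where F = F and F' = F' and \<epsilon> = \<epsilon> and y = y and ?z0.0 = z0 and R = R,
      OF sol F_lip F'_lip F'_bound eps_pos retract eq_refl[OF D_def[symmetric]]]
  have G_bound: "norm (G h t) \<le> L t" if "t \<ge> 0" for h t
    using Phi_ball'(1)[OF that, of "h - y"] bound_nonneg[OF that] by (simp add: G_def L_def)
  have G_lip: "norm (G h t - G k t) \<le> L t * norm (h - k)" if t: "t \<ge> 0" for h k t
  proof -
    have "norm (G h t - G k t) \<le> Phi_lipschitz N1 N2 R D (\<epsilon> t)
        * norm (radial_retract R (h - y) - radial_retract R (k - y))"
      using Phi_ball'(2)[OF t retract, of "h - y" "k - y"] by (simp add: G_def)
    also have "\<dots> \<le> Phi_lipschitz N1 N2 R D (\<epsilon> t) * (2 * norm (h - k))"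
      using radial_retract_lipschitz[OF R, of "h - y" "k - y"] bound_nonneg[OF t]
      by (intro mult_left_mono) auto
    also have "\<dots> \<le> L t * norm (h - k)"
      using bound_nonneg[OF t] by (simp add: L_def algebra_simps)
    finally show ?thesis .
  qed
  have G_cont: "continuous_on {0..} (\<lambda>t. G (z t) t)" if z: "continuous_on {0..} z" for z
    unfolding G_def radial_retract_def
    by (intro continuous_on_Phi F_cont eps_cont continuous_intros z) (use R eps_pos in \<open>auto simp: max_def\<close>)
  have "\<exists>z. solves_cauchy G z0 z"
    by (rule solves_cauchy_exists[OF G_cont L_cont _ G_lip G_bound])
      (use bound_nonneg in \<open>auto simp: L_def\<close>)
  then obtain z where z: "solves_cauchy G z0 z" by blast
  \<comment> \<open>Used in both directions: from the cut-off problem to the original one for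
    existence, and back for uniqueness, where the global Lipschitz bound is available.\<close>
  have transfer: "solves_cauchy g' z0 w"
    if w: "solves_cauchy g z0 w" and g: "\<And>h t. norm (h - y) \<le> R \<Longrightarrow> g h t = Phi F F' z0 \<epsilon> h t"
      and g': "\<And>h t. norm (h - y) \<le> R \<Longrightarrow> g' h t = Phi F F' z0 \<epsilon> h t" for g g' w
    unfolding solves_cauchy_def
  proof (intro conjI allI impI)
    fix t :: real assume t: "t \<ge> 0"
    have "norm (w t - y) \<le> R" using stays[OF w g t] \<rho>_le[OF t] by simp
    then have "g (w t) t = g' (w t) t" by (simp add: g g')
    then show "(w has_vector_derivative g' (w t) t) (at t within {0..})"
      using solves_cauchyD(2)[OF w t] by simp
  qed (rule solves_cauchyD(1)[OF w])
  show ?thesis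
  proof (intro exI[of _ z] conjI allI impI)
    show "solves_cauchy (Phi F F' z0 \<epsilon>) z0 z" by (rule transfer[OF z G refl])
    show "w t = z t" if w: "solves_cauchy (Phi F F' z0 \<epsilon>) z0 w" and t: "t \<ge> 0" for w t
      by (rule solves_cauchy_unique[OF L_cont G_lip transfer[OF w refl G] z t])
    show "norm (z t - y) \<le> 2 * C0 / (N2 * \<epsilon> 0 powr (\<zeta> - 1/2)) * \<epsilon> t powr \<zeta>" if "t \<ge> 0" for t
      using stays[OF z G that] by (simp add: \<rho>_def U_def \<kappa>_def)
  qed
qed

end
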